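(* Let $(G_n)$ be a sequence of abelian groups and $Y_n\subseteq G_n$ with $|Y_n|=n$. Let $m=m(n)$, $s=s(n)$, $s'=s'(n)$ be positive integers such that $s'=\Theta(s)$ (i.e. there is a constant $C\ge1$ with $s/C\le s'\le Cs$ for all $n$), $s+s'\le m$, and $m=o\!\left(\frac{s^2}{(\log n)^2}\right)$ as $n\to\infty$. Then there exist sequences $\varepsilon_n\to0$ and $\eta_n\to0$ such that the number of pairs $(A,B)$ of subsets of $Y_n$ with $|A|=s$, $|B|=s'$ and $|A+B|\le m$ is at most \[2^{\varepsilon_n s}\binom{\frac{(m+\beta)s}{s+s'}}{s}\binom{\frac{(m+\beta)s'}{s+s'}}{s'},\qquad \beta=\beta_{G_n}\big((1+\eta_n)m\big).\]
   Context: For an abelian group $G$ and real $x>0$, $\beta_G(x)$ denotes the largest size of a subgroup $H\le G$ with $|H|\le x$. $A+B=\{a+b:a\in A,b\in B\}$. For real $x$ and integer $s\ge0$, $\binom{x}{s}=x(x-1)\cdots(x-s+1)/s!$ if $x\ge s$ and $0$ otherwise. Logarithms are base $2$. *)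

theory Defs
  imports Complex_Main "HOL-Library.Landau_Symbols" "HOL-Algebra.Coset"
begin

text \<open>
  Abelian groups are written multiplicatively, so the sumset of \<open>A\<close> and \<open>B\<close> in \<open>G\<close> is
  \<open>A <#>\<^bsub>G\<^esub> B\<close>.
\<close>

text \<open>
  The explicit finiteness condition is needed because the cardinality of an infinite set is 0.
  The value is meaningful only for \<open>x \<ge> 1\<close>; for smaller \<open>x\<close> no subgroup qualifies.
\<close>

definition max_subgroup_size :: "('a, 'b) monoid_scheme \<Rightarrow> real \<Rightarrow> nat" where
  "max_subgroup_size G x = Max {card H |H. subgroup H G \<and> finite H \<and> real (card H) \<le> x}"

text \<open>
  Unlike the library's generalised binomial coefficient, this one vanishes for \<open>x < s\<close>.
\<close>

definition real_choose :: "real \<Rightarrow> nat \<Rightarrow> real" where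
  "real_choose x s = (if x \<ge> real s then x gchoose s else 0)"

end

theory Submission
  imports Defs "HOL-Real_Asymp.Real_Asymp"
begin

text \<open>
  Every pair \<open>(A, B)\<close> with \<open>|AB| \<le> m\<close> is trapped in one of \<open>n\<^bsup>O(\<surd>m)\<^esup> = 2\<^bsup>o(s)\<^esup>\<close> pairs of containers
  \<open>(X, Z)\<close>, found as follows. Given a set \<open>F \<subseteq> B\<close> of order \<open>\<surd>m\<close>, pick elements of \<open>A\<close> greedily as long
  as \<open>aF\<close> contains many new elements; since \<open>|AB| \<le> m\<close>, this stops after \<open>O(\<surd>m)\<close> steps, and the chosen
  \<open>S \<subseteq> A\<close> has the property that \<open>aF\<close> is almost contained in the known set \<open>C = SF \<subseteq> AB\<close> for all
  \<open>a \<in> A\<close>. Hence \<open>A\<close> lies in the set of all \<open>x\<close> with this property, a set determined by \<open>(S, F)\<close>. As long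
  as many \<open>z \<in> Z\<close> have many \<open>x \<in> X\<close> with \<open>xz \<notin> C\<close>, either few of these \<open>z\<close> are in \<open>B\<close> and the others can
  be deleted from \<open>Z\<close>, or \<open>F\<close> can be chosen among them and then \<open>X\<close> shrinks or \<open>C\<close> grows by a positive
  proportion of \<open>m\<close>. So boundedly many rounds suffice.

  At the end almost all products \<open>xz\<close> are in \<open>C\<close>, where \<open>|C| \<le> m\<close>. A Pollard-type strengthening of Kneser's
  theorem, proved with Dyson's transform, then gives \<open>|X| + |Z| \<le> (1 + o(1))(m + \<beta>)\<close>. Finally,
  a product of two binomial coefficients with the sum of the upper entries fixed is largest, up to a
  polynomial factor, when the upper entries are proportional to the lower ones.
\<close>

section \<open>A Pollard-type theorem for abelian groups\<close>

definition reps :: "('a, 'b) monoid_scheme \<Rightarrow> 'a set \<Rightarrow> 'a set \<Rightarrow> 'a \<Rightarrow> ('a \<times> 'a) set" where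
  "reps G A B x = {(a, b). a \<in> A \<and> b \<in> B \<and> a \<otimes>\<^bsub>G\<^esub> b = x}"

text \<open>The quantity in Pollard's theorem: the sum over \<open>i = 1, ..., t\<close> of the
  number of elements with at least \<open>i\<close> representations. For \<open>t = 1\<close> it is
  the size of the product set.\<close>

definition pollard_sum :: "('a, 'b) monoid_scheme \<Rightarrow> nat \<Rightarrow> 'a set \<Rightarrow> 'a set \<Rightarrow> nat" where
  "pollard_sum G t A B = (\<Sum>x\<in>A <#>\<^bsub>G\<^esub> B. min t (card (reps G A B x)))"

lemma finite_reps: "finite A \<Longrightarrow> finite B \<Longrightarrow> finite (reps G A B x)"
  by (rule finite_subset[of _ "A \<times> B"]) (auto simp: reps_def)

lemma finite_set_mult: "finite A \<Longrightarrow> finite B \<Longrightarrow> finite (A <#>\<^bsub>G\<^esub> B)"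
  by (auto simp: set_mult_def)

lemma reps_empty_iff: "reps G A B x = {} \<longleftrightarrow> x \<notin> A <#>\<^bsub>G\<^esub> B"
  by (auto simp: reps_def set_mult_def)

text \<open>Elements without representations add zero. A common index set \<open>D\<close> allows
  sums for different pairs of sets to be compared term by term.\<close>

lemma pollard_sum_superset:
  assumes "finite D" "A <#>\<^bsub>G\<^esub> B \<subseteq> D"
  shows "pollard_sum G t A B = (\<Sum>x\<in>D. min t (card (reps G A B x)))"
  unfolding pollard_sum_def using assms
  by (intro sum.mono_neutral_left) (auto simp: reps_empty_iff[symmetric])

lemma sum_card_reps:
  assumes "finite A" "finite B"
  shows "(\<Sum>x\<in>A <#>\<^bsub>G\<^esub> B. card (reps G A B x)) = card A * card B"
proof -
  have "card A * card B = card (\<Union>x\<in>A <#>\<^bsub>G\<^esub> B. reps G A B x)"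
    by (subst card_cartesian_product[symmetric], rule arg_cong[of _ _ card])
       (auto simp: reps_def set_mult_def)
  also have "\<dots> = (\<Sum>x\<in>A <#>\<^bsub>G\<^esub> B. card (reps G A B x))"
    using assms by (intro card_UN_disjoint) (auto simp: finite_reps finite_set_mult, auto simp: reps_def)
  finally show ?thesis by simp
qed

text \<open>An element of \<open>C\<close> contributes at most \<open>t\<close>, any other element
  at most all its representations. So a small \<open>C\<close> that catches almost all products
  forces a small sum, to be played off against \<open>pollard_kneser\<close>.\<close>

lemma pollard_sum_le:
  assumes "finite A" "finite B" "finite C"
  shows "pollard_sum G t A B
    \<le> t * card C + card {(a, b). a \<in> A \<and> b \<in> B \<and> a \<otimes>\<^bsub>G\<^esub> b \<notin> C}"
proof -
  let ?D = "A <#>\<^bsub>G\<^esub> B"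
  have fD: "finite ?D" using assms by (simp add: finite_set_mult)
  have "pollard_sum G t A B = (\<Sum>x\<in>?D \<inter> C. min t (card (reps G A B x)))
      + (\<Sum>x\<in>?D - C. min t (card (reps G A B x)))"
    unfolding pollard_sum_def using fD by (rule sum.Int_Diff)
  also have "(\<Sum>x\<in>?D \<inter> C. min t (card (reps G A B x))) \<le> card (?D \<inter> C) * t"
    using sum_bounded_above[of "?D \<inter> C" "\<lambda>x. min t (card (reps G A B x))" t] by simp
  also have "card (?D \<inter> C) * t \<le> t * card C"
    using assms(3) by (simp add: card_mono)
  also have "(\<Sum>x\<in>?D - C. min t (card (reps G A B x))) \<le> (\<Sum>x\<in>?D - C. card (reps G A B x))"
    by (intro sum_mono) simp
  also have "\<dots> = card (\<Union>x\<in>?D - C. reps G A B x)"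
    using assms fD by (intro card_UN_disjoint[symmetric]) (auto simp: finite_reps, auto simp: reps_def)
  also have "(\<Union>x\<in>?D - C. reps G A B x) = {(a, b). a \<in> A \<and> b \<in> B \<and> a \<otimes>\<^bsub>G\<^esub> b \<notin> C}"
    by (auto simp: reps_def set_mult_def)
  finally show ?thesis by simp
qed

section \<open>Translations and Dyson's transform\<close>

context comm_group
begin

lemma card_left_translate:
  assumes "B \<subseteq> carrier G" "e \<in> carrier G"
  shows "card ((\<otimes>) e ` B) = card B"
  using assms by (intro card_image) (auto simp: inj_on_def subset_iff)

text \<open>Multiplying \<open>B\<close> by \<open>e\<close> only relabels the products. This
  freedom lets the induction move \<open>B\<close> so that it meets \<open>A\<close> without being
  contained in it.\<close>

lemma pollard_sum_translate:
  assumes "A \<subseteq> carrier G" "B \<subseteq> carrier G" "e \<in> carrier G"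
  shows "pollard_sum G t A ((\<otimes>) e ` B) = pollard_sum G t A B"
proof -
  have *: "a \<otimes> (e \<otimes> b) = e \<otimes> (a \<otimes> b)" if "a \<in> A" "b \<in> B" for a b
    using that assms by (auto intro!: m_lcomm)
  have img: "A <#> ((\<otimes>) e ` B) = (\<otimes>) e ` (A <#> B)"
  proof -
    have "A <#> ((\<otimes>) e ` B) = (\<Union>a\<in>A. \<Union>b\<in>B. {a \<otimes> (e \<otimes> b)})"
      by (auto simp: set_mult_def)
    also have "\<dots> = (\<Union>a\<in>A. \<Union>b\<in>B. {e \<otimes> (a \<otimes> b)})"
      using * by auto
    also have "\<dots> = (\<otimes>) e ` (A <#> B)" by (auto simp: set_mult_def)
    finally show ?thesis .
  qed
  have sub: "A <#> B \<subseteq> carrier G" using assms by (simp add: set_mult_closed)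
  have "card (reps G A ((\<otimes>) e ` B) (e \<otimes> x)) = card (reps G A B x)" if "x \<in> A <#> B" for x
  proof -
    have x: "x \<in> carrier G" using that sub by blast
    have "bij_betw (\<lambda>(a, b). (a, e \<otimes> b)) (reps G A B x) (reps G A ((\<otimes>) e ` B) (e \<otimes> x))"
    proof (rule bij_betw_imageI)
      show "inj_on (\<lambda>(a, b). (a, e \<otimes> b)) (reps G A B x)"
        using assms(2,3) by (auto simp: inj_on_def reps_def subset_iff)
      show "(\<lambda>(a, b). (a, e \<otimes> b)) ` reps G A B x = reps G A ((\<otimes>) e ` B) (e \<otimes> x)"
      proof (intro equalityI subsetI)
        fix p assume "p \<in> (\<lambda>(a, b). (a, e \<otimes> b)) ` reps G A B x"
        then show "p \<in> reps G A ((\<otimes>) e ` B) (e \<otimes> x)"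
          using * by (auto simp: reps_def)
      next
        fix p assume "p \<in> reps G A ((\<otimes>) e ` B) (e \<otimes> x)"
        then obtain a b where p: "p = (a, e \<otimes> b)" "a \<in> A" "b \<in> B" "a \<otimes> (e \<otimes> b) = e \<otimes> x"
          by (auto simp: reps_def)
        then have "e \<otimes> (a \<otimes> b) = e \<otimes> x" using * by simp
        then have "a \<otimes> b = x" using p assms x by (auto simp: subset_iff)
        then show "p \<in> (\<lambda>(a, b). (a, e \<otimes> b)) ` reps G A B x"
          using p by (auto simp: reps_def image_iff)
      qed
    qed
    then show ?thesis by (simp add: bij_betw_same_card)
  qed
  moreover have "inj_on ((\<otimes>) e) (A <#> B)"
    using sub assms(3) by (auto simp: inj_on_def subset_iff)
  ultimately show ?thesis
    unfolding pollard_sum_def img by (simp add: sum.reindex)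
qed

text \<open>Dyson's transform replaces \<open>(A, B)\<close> by \<open>(A \<union> B, A \<inter> B)\<close>; a pair whose first component lies
  outside \<open>A\<close> is turned into a pair of \<open>A \<times> B\<close> by swapping it.\<close>

lemma card_reps_dyson:
  assumes "finite A" "finite B" "A \<subseteq> carrier G" "B \<subseteq> carrier G"
  shows "card (reps G (A \<union> B) (A \<inter> B) x) + card (reps G (A - B) (B - A) x) \<le> card (reps G A B x)"
proof -
  define f where "f = (\<lambda>(u, v). if u \<in> A then (u, v) else (v, u))"
  let ?R = "reps G (A \<union> B) (A \<inter> B) x" and ?Q = "reps G (A - B) (B - A) x"
  have inj: "inj_on f ?R"
    by (auto simp: inj_on_def f_def reps_def split: if_splits)
  have sub: "f ` ?R \<subseteq> reps G A B x"
    using assms(3,4) by (auto simp: f_def reps_def subset_iff m_comm split: if_splits)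
  have disj: "f ` ?R \<inter> ?Q = {}"
    by (auto simp: f_def reps_def split: if_splits)
  have "card ?R + card ?Q = card (f ` ?R \<union> ?Q)"
    using assms disj inj by (subst card_Un_disjoint) (auto simp: finite_reps card_image)
  also have "\<dots> \<le> card (reps G A B x)"
    using sub assms by (intro card_mono finite_reps) (auto simp: reps_def)
  finally show ?thesis .
qed

text \<open>Sums \<open>card_reps_dyson\<close>, using
  \<open>min u p + min v q <= min (u + v) (p + q)\<close>. The leftover pair
  \<open>(A - B, B - A)\<close> absorbs the part of the level for which the intersection is too
  small.\<close>

lemma pollard_sum_dyson:
  assumes "finite A" "finite B" "A \<subseteq> carrier G" "B \<subseteq> carrier G"
  shows "pollard_sum G u (A \<union> B) (A \<inter> B) + pollard_sum G v (A - B) (B - A)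
    \<le> pollard_sum G (u + v) A B"
proof -
  let ?D = "(A \<union> B) <#> (A \<union> B)"
  have fD: "finite ?D" using assms by (simp add: finite_set_mult)
  have sub: "A' <#> B' \<subseteq> ?D" if "A' \<subseteq> A \<union> B" "B' \<subseteq> A \<union> B" for A' B'
    using that by (rule mono_set_mult)
  have "pollard_sum G u (A \<union> B) (A \<inter> B) + pollard_sum G v (A - B) (B - A)
      = (\<Sum>x\<in>?D. min u (card (reps G (A \<union> B) (A \<inter> B) x)) + min v (card (reps G (A - B) (B - A) x)))"
    unfolding sum.distrib
    by (intro arg_cong2[of _ _ _ _ "(+)"] pollard_sum_superset fD sub) auto
  also have "\<dots> \<le> (\<Sum>x\<in>?D. min (u + v) (card (reps G A B x)))"
  proof (rule sum_mono)
    fix x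
    show "min u (card (reps G (A \<union> B) (A \<inter> B) x)) + min v (card (reps G (A - B) (B - A) x))
        \<le> min (u + v) (card (reps G A B x))"
      using card_reps_dyson[OF assms, of x] by linarith
  qed
  also have "\<dots> = pollard_sum G (u + v) A B"
    by (intro pollard_sum_superset[symmetric] fD sub) auto
  finally show ?thesis .
qed

section \<open>Stabilizers and the induction for the Pollard-type bound\<close>

lemma card_reps_le:
  assumes "finite B" "A \<subseteq> carrier G" "B \<subseteq> carrier G"
  shows "card (reps G A B x) \<le> card B"
proof -
  have "inj_on snd (reps G A B x)"
    using assms by (auto simp: inj_on_def reps_def subset_iff)
  then show ?thesis
    using assms by (intro card_inj_on_le[of snd]) (auto simp: reps_def)
qed

lemma pollard_sum_card_right:
  assumes "finite A" "finite B" "A \<subseteq> carrier G" "B \<subseteq> carrier G"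
  shows "pollard_sum G (card B) A B = card A * card B"
  unfolding pollard_sum_def sum_card_reps[OF assms(1,2), symmetric, of G]
  using card_reps_le[OF assms(2-4)] by (intro sum.cong) auto

text \<open>Multiplication with a fixed \<open>a0\<close> in \<open>A\<close> embeds
  \<open>H\<close> into \<open>A\<close>. Inverses come from finiteness: right multiplication by
  \<open>h\<close> is an injection of \<open>A\<close> into itself, hence onto.\<close>

lemma subgroup_right_stabilizer:
  assumes "finite A" "A \<subseteq> carrier G" "A \<noteq> {}"
  defines "H \<equiv> {h \<in> carrier G. \<forall>a\<in>A. a \<otimes> h \<in> A}"
  shows "subgroup H G" "finite H" "card H \<le> card A"
proof -
  obtain a0 where a0: "a0 \<in> A" using assms by blast
  have inj: "inj_on (\<lambda>h. a0 \<otimes> h) H" using a0 assms by (auto simp: inj_on_def H_def subset_iff)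
  have img: "(\<lambda>h. a0 \<otimes> h) ` H \<subseteq> A" using a0 by (auto simp: H_def)
  show "finite H" using inj img assms(1) by (rule inj_on_finite)
  show "card H \<le> card A" using inj img assms(1) by (intro card_inj_on_le)
  show "subgroup H G"
  proof (rule subgroupI)
    show "H \<subseteq> carrier G" by (auto simp: H_def)
    show "H \<noteq> {}" using assms(2) by (auto simp: H_def subset_iff intro!: exI[of _ \<one>])
    show "h \<otimes> k \<in> H" if "h \<in> H" "k \<in> H" for h k
      using that assms(2) by (auto simp: H_def subset_iff m_assoc[symmetric])
    show "inv h \<in> H" if h: "h \<in> H" for h
    proof -
      have hc: "h \<in> carrier G" using h by (simp add: H_def)
      have "inj_on (\<lambda>a. a \<otimes> h) A" using hc assms(2) by (auto simp: inj_on_def subset_iff)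
      moreover have "(\<lambda>a. a \<otimes> h) ` A \<subseteq> A" using h by (auto simp: H_def)
      ultimately have surj: "(\<lambda>a. a \<otimes> h) ` A = A" using assms(1) by (intro endo_inj_surj)
      have "a \<otimes> inv h \<in> A" if a: "a \<in> A" for a
      proof -
        obtain a' where a': "a' \<in> A" "a = a' \<otimes> h" using surj a by blast
        then have "a \<otimes> inv h = a'" using hc assms(2) by (auto simp: m_assoc subset_iff)
        then show ?thesis using a' by simp
      qed
      then show ?thesis using hc by (simp add: H_def)
    qed
  qed
qed

text \<open>If every Dyson transform is trivial, then \<open>B\<close> lies in a coset of the stabilizer of \<open>A\<close>.\<close>

lemma pollard_terminal:
  assumes "finite A" "finite B" "A \<subseteq> carrier G" "B \<subseteq> carrier G"
    and "A \<noteq> {}" "B \<noteq> {}" "t \<le> card B"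
    and stable: "\<And>a b b'. a \<in> A \<Longrightarrow> b \<in> B \<Longrightarrow> b' \<in> B \<Longrightarrow> a \<otimes> inv b \<otimes> b' \<in> A"
  shows "t * card A \<le> pollard_sum G t A B"
    and "\<exists>H. subgroup H G \<and> finite H \<and> card B \<le> card H \<and> card H \<le> card A"
proof -
  obtain b0 where b0: "b0 \<in> B" using assms by blast
  then have b0c: "b0 \<in> carrier G" using assms by blast
  \<comment> \<open>Every \<open>b\<close> in \<open>B\<close> is the second factor of a
    representation of \<open>a \<otimes> b0\<close>, the first factor being
    \<open>a \<otimes> inv b \<otimes> b0\<close>.\<close>
  have reps: "t \<le> card (reps G A B (a \<otimes> b0))" if a: "a \<in> A" for a
  proof -
    have "(\<lambda>b. (a \<otimes> inv b \<otimes> b0, b)) ` B \<subseteq> reps G A B (a \<otimes> b0)"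
    proof (clarsimp simp: reps_def)
      fix b assume b: "b \<in> B"
      have c: "a \<in> carrier G" "b \<in> carrier G" using a b assms by auto
      have "a \<otimes> inv b \<otimes> b0 \<otimes> b = a \<otimes> (inv b \<otimes> (b \<otimes> b0))"
        using c b0c by (simp add: m_assoc m_comm[of b0 b])
      also have "\<dots> = a \<otimes> b0" using c b0c by (simp add: m_assoc[symmetric])
      finally show "a \<otimes> inv b \<otimes> b0 \<in> A \<and> a \<otimes> inv b \<otimes> b0 \<otimes> b = a \<otimes> b0"
        using stable[OF a b b0] by simp
    qed
    then have "card B \<le> card (reps G A B (a \<otimes> b0))"
      by (intro card_inj_on_le[of "\<lambda>b. (a \<otimes> inv b \<otimes> b0, b)"] finite_reps assms)
         (auto simp: inj_on_def)
    with assms show ?thesis by simp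
  qed
  have "t * card A = (\<Sum>x\<in>(\<lambda>a. a \<otimes> b0) ` A. t)"
    using assms b0c by (subst sum_constant, subst card_image) (auto simp: inj_on_def subset_iff)
  also have "\<dots> \<le> (\<Sum>x\<in>(\<lambda>a. a \<otimes> b0) ` A. min t (card (reps G A B x)))"
    using reps by (intro sum_mono) auto
  also have "\<dots> \<le> pollard_sum G t A B"
    unfolding pollard_sum_def using assms b0
    by (intro sum_mono2) (auto simp: finite_set_mult, auto simp: set_mult_def)
  finally show "t * card A \<le> pollard_sum G t A B" .
  let ?H = "{h \<in> carrier G. \<forall>a\<in>A. a \<otimes> h \<in> A}"
  note H = subgroup_right_stabilizer[OF assms(1,3,5)]
  have sub: "(\<otimes>) (inv b0) ` B \<subseteq> ?H"
    using assms b0 b0c by (auto simp: subset_iff m_assoc[symmetric])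
  have "card B = card ((\<otimes>) (inv b0) ` B)"
    by (rule card_left_translate[OF assms(4) inv_closed[OF b0c], symmetric])
  also have "\<dots> \<le> card ?H"
    by (rule card_mono[OF H(2) sub])
  finally have "card B \<le> card ?H" .
  with H show "\<exists>H. subgroup H G \<and> finite H \<and> card B \<le> card H \<and> card H \<le> card A"
    by blast
qed

text \<open>Induction on \<open>card B\<close>. If some translate of \<open>B\<close> meets
  \<open>A\<close> without lying in it, Dyson's transform gives pairs with a smaller second set.
  Otherwise \<open>B\<close> lies in a coset of the stabilizer of \<open>A\<close>, and the size of
  that stabilizer decides which term of the minimum is used.\<close>

theorem pollard_kneser:
  fixes L \<beta> :: real
  assumes "finite A" "finite B" "A \<subseteq> carrier G" "B \<subseteq> carrier G"
    and "0 < t" "t \<le> card A" "t \<le> card B"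
    and sub: "\<And>H. subgroup H G \<Longrightarrow> finite H \<Longrightarrow> real (card H) \<le> L \<Longrightarrow> real (card H) \<le> \<beta>"
    and "0 \<le> \<beta>"
  shows "real t * min L (real (card A) + real (card B) - real t - \<beta>) \<le> real (pollard_sum G t A B)"
  using assms(1-7)
proof (induction "card B" arbitrary: A B t rule: less_induct)
  case less
  have ne: "A \<noteq> {}" "B \<noteq> {}" using less.prems by auto
  show ?case
  proof (cases "\<forall>a\<in>A. \<forall>b\<in>B. \<forall>b'\<in>B. a \<otimes> inv b \<otimes> b' \<in> A")
    case True
    note fin = pollard_terminal[OF less.prems(1-4) ne less.prems(7), OF True[rule_format]]
    obtain H where H: "subgroup H G" "finite H" "card B \<le> card H" "card H \<le> card A"
      using fin(2) by blast
    \<comment> \<open>If \<open>card H <= L\<close>, then \<open>card B <= card H <= \<beta>\<close>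
      and the second term is at most \<open>card A\<close>; otherwise
      \<open>L < card H <= card A\<close>.\<close>
    have "min L (real (card A) + real (card B) - real t - \<beta>) \<le> real (card A)"
    proof (cases "real (card H) \<le> L")
      case True
      with sub[OF H(1,2)] H(3) show ?thesis by auto
    next
      case False
      with H(4) show ?thesis by auto
    qed
    then have "real t * min L (real (card A) + real (card B) - real t - \<beta>) \<le> real t * real (card A)"
      by (intro mult_left_mono) auto
    also have "\<dots> \<le> real (pollard_sum G t A B)"
      using fin(1) by (metis of_nat_le_iff of_nat_mult)
    finally show ?thesis .
  next
    case False
    then obtain a b b' where ab: "a \<in> A" "b \<in> B" "b' \<in> B" "a \<otimes> inv b \<otimes> b' \<notin> A" by blast
    have abc: "a \<in> carrier G" "b \<in> carrier G" using ab less.prems by auto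
    \<comment> \<open>Translation by \<open>e\<close> sends \<open>b\<close> to \<open>a\<close>,
      inside \<open>A\<close>, and \<open>b'\<close> to a point outside \<open>A\<close>, so the
      intersection is nonempty and smaller than \<open>B\<close>.\<close>
    define e where "e = a \<otimes> inv b"
    have e: "e \<in> carrier G" using abc by (simp add: e_def)
    define E where "E = (\<otimes>) e ` B"
    have cardE: "card E = card B"
      unfolding E_def using less.prems e by (intro card_left_translate)
    have sumE: "pollard_sum G t A E = pollard_sum G t A B"
      unfolding E_def using less.prems e by (intro pollard_sum_translate)
    have fE: "finite E" "E \<subseteq> carrier G" using less.prems e by (auto simp: E_def)
    have "a \<in> E" using ab abc by (auto simp: E_def e_def image_iff m_assoc intro!: bexI[of _ b])
    have "e \<otimes> b' \<in> E - A" using ab by (auto simp: E_def e_def)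
    define u where "u = card (A \<inter> E)"
    have u_pos: "0 < u" using \<open>a \<in> E\<close> ab less.prems by (auto simp: u_def card_gt_0_iff)
    have u_less: "u < card B" unfolding u_def cardE[symmetric]
      using \<open>e \<otimes> b' \<in> E - A\<close> fE by (intro psubset_card_mono) auto
    have cU: "card (A \<union> E) + u = card A + card B"
      unfolding u_def cardE[symmetric] using card_Un_Int[OF less.prems(1) fE(1)] by simp
    show ?thesis
    proof (cases "t \<le> u")
      case True
      have "t \<le> card (A \<union> E)"
        using less.prems(1,6) fE card_mono[of "A \<union> E" A] by simp
      then have "real t * min L (real (card (A \<union> E)) + real (card (A \<inter> E)) - real t - \<beta>)
          \<le> real (pollard_sum G t (A \<union> E) (A \<inter> E))"
        using less.prems fE u_less True by (intro less.hyps) (auto simp: u_def)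
      also have "\<dots> \<le> real (pollard_sum G (t + 0) A E)"
        using pollard_sum_dyson[OF less.prems(1) fE(1) less.prems(3) fE(2), of t 0] by simp
      finally show ?thesis
        using cU sumE by (simp add: u_def[symmetric] flip: of_nat_add)
    next
      case False
      \<comment> \<open>Here the intersection has only \<open>u < t\<close> elements. At level
        \<open>u\<close>, union and intersection contribute all their pairs; the remaining level
        \<open>v\<close> goes to the two differences, by induction.\<close>
      define v where "v = t - u"
      have v: "0 < v" "t = u + v" using False by (auto simp: v_def)
      have cA: "card (A - E) + u = card A" and cB: "card (E - A) + u = card B"
        unfolding u_def cardE[symmetric] 
        using card_Int_Diff[OF less.prems(1), of E] card_Int_Diff[OF fE(1), of A]
        by (simp_all add: Int_commute)
      have IH: "real v * min L (real (card (A - E)) + real (card (E - A)) - real v - \<beta>)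
          \<le> real (pollard_sum G v (A - E) (E - A))"
        using less.prems fE u_pos v cA cB by (intro less.hyps) auto
      define q where "q = real (card A) + real (card B)"
      have eqs: "real (card (A - E)) + real (card (E - A)) = q - 2 * real u"
        "real (card (A \<union> E)) = q - real u"
        using cA cB cU unfolding q_def by linarith+
      have full: "real (pollard_sum G u (A \<union> E) (A \<inter> E)) = real u * (q - real u)"
      proof -
        have "pollard_sum G u (A \<union> E) (A \<inter> E) = card (A \<union> E) * u"
          unfolding u_def using less.prems fE by (intro pollard_sum_card_right) auto
        then show ?thesis using eqs(2) by simp
      qed
      \<comment> \<open>Since \<open>t (q - t) = u (q - u) + v (q - 2 u - v)\<close>, the inequality
        between the second terms of the minima holds with \<open>u \<beta>\<close> to spare.\<close>
      have "real t * min L (q - real t - \<beta>)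
          \<le> real u * (q - real u) + real v * min L (q - 2 * real u - real v - \<beta>)"
      proof (cases "L \<le> q - 2 * real u - real v - \<beta>")
        case True
        have "min L (q - real t - \<beta>) \<le> q - real u" "min L (q - real t - \<beta>) \<le> L"
          using v \<open>0 \<le> \<beta>\<close> by auto
        then have "real u * min L (q - real t - \<beta>) + real v * min L (q - real t - \<beta>)
            \<le> real u * (q - real u) + real v * L"
          by (intro add_mono mult_left_mono) auto
        then show ?thesis using True v by (simp add: algebra_simps)
      next
        case False
        have "real t * min L (q - real t - \<beta>) \<le> real t * (q - real t - \<beta>)"
          by (intro mult_left_mono) auto
        also have "\<dots> \<le> real u * (q - real u) + real v * (q - 2 * real u - real v - \<beta>)"
          using v \<open>0 \<le> \<beta>\<close> by (simp add: algebra_simps)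
        finally show ?thesis using False by simp
      qed
      also have "\<dots> \<le> real (pollard_sum G u (A \<union> E) (A \<inter> E)) + real (pollard_sum G v (A - E) (E - A))"
        using IH full eqs by simp
      also have "\<dots> \<le> real (pollard_sum G t A E)"
        using pollard_sum_dyson[OF less.prems(1) fE(1) less.prems(3) fE(2), of u v] v
        by (simp flip: of_nat_add)
      finally show ?thesis using sumE by (simp add: q_def)
    qed
  qed
qed

end

section \<open>Containers\<close>

text \<open>\<open>C\<close> records products known to occur for every pair of the class. It lies in
  a set of at most \<open>m\<close> elements, so its growth measures progress.\<close>

definition small_pairs ::
    "('a, 'b) monoid_scheme \<Rightarrow> nat \<Rightarrow> nat \<Rightarrow> nat \<Rightarrow> 'a set \<Rightarrow> 'a set \<Rightarrow> 'a set \<Rightarrow> ('a set \<times> 'a set) set" where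
  "small_pairs G s s' m X Z C = {(A, B). A \<subseteq> X \<and> B \<subseteq> Z \<and> card A = s \<and> card B = s' \<and>
     card (A <#>\<^bsub>G\<^esub> B) \<le> m \<and> C \<subseteq> A <#>\<^bsub>G\<^esub> B}"

definition shrink :: "('a, 'b) monoid_scheme \<Rightarrow> nat \<Rightarrow> 'a set \<Rightarrow> 'a set \<Rightarrow> 'a set \<Rightarrow> 'a set" where
  "shrink G d X F C = {x \<in> X. card {b \<in> F. x \<otimes>\<^bsub>G\<^esub> b \<notin> C} < d}"

text \<open>Degree refers to the bipartite graph joining \<open>x\<close> to \<open>z\<close> when
  their product is in \<open>C\<close>: these vertices miss at least a proportion
  \<open>\<theta>\<close> of \<open>X\<close>.\<close>

definition low_degree :: "('a, 'b) monoid_scheme \<Rightarrow> real \<Rightarrow> 'a set \<Rightarrow> 'a set \<Rightarrow> 'a set \<Rightarrow> 'a set" where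
  "low_degree G \<theta> X Z C = {z \<in> Z. \<theta> * real (card X) \<le> real (card {x \<in> X. x \<otimes>\<^bsub>G\<^esub> z \<notin> C})}"

definition small_subsets :: "'a set \<Rightarrow> nat \<Rightarrow> 'a set set" where
  "small_subsets Y j = {F. F \<subseteq> Y \<and> card F \<le> j}"

lemma finite_small_subsets: "finite Y \<Longrightarrow> finite (small_subsets Y j)"
  by (auto simp: small_subsets_def)

text \<open>A set with at most \<open>j + 1\<close> elements has at most \<open>j\<close> or arises
  from such a set by inserting an element of \<open>Y\<close>, so each step costs a factor
  \<open>card Y + 1\<close>.\<close>

lemma card_small_subsets_le:
  assumes "finite Y"
  shows "card (small_subsets Y j) \<le> (card Y + 1) ^ j"
proof (induction j)
  case 0
  have "small_subsets Y 0 = {{}}"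
    using assms by (auto simp: small_subsets_def dest: finite_subset)
  then show ?case by simp
next
  case (Suc j)
  let ?W = "small_subsets Y j"
  have fin: "finite ?W" using assms by (rule finite_small_subsets)
  have "small_subsets Y (Suc j) \<subseteq> ?W \<union> (\<lambda>(x, F). insert x F) ` (Y \<times> ?W)"
  proof
    fix F assume F: "F \<in> small_subsets Y (Suc j)"
    show "F \<in> ?W \<union> (\<lambda>(x, F). insert x F) ` (Y \<times> ?W)"
    proof (cases "F = {}")
      case True
      then show ?thesis by (simp add: small_subsets_def)
    next
      case False
      then obtain x where x: "x \<in> F" by blast
      have "finite F" using F assms by (auto simp: small_subsets_def dest: finite_subset)
      then have "F - {x} \<in> ?W" using F x by (auto simp: small_subsets_def)
      moreover have "F = insert x (F - {x})" "x \<in> Y" using x F by (auto simp: small_subsets_def)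
      ultimately show ?thesis
        by (intro UnI2 image_eqI[of _ _ "(x, F - {x})"]) simp_all
    qed
  qed
  then have "card (small_subsets Y (Suc j)) \<le> card (?W \<union> (\<lambda>(x, F). insert x F) ` (Y \<times> ?W))"
    using fin assms by (intro card_mono) auto
  also have "\<dots> \<le> card ?W + card ((\<lambda>(x, F). insert x F) ` (Y \<times> ?W))"
    by (rule card_Un_le)
  also have "card ((\<lambda>(x, F). insert x F) ` (Y \<times> ?W)) \<le> card (Y \<times> ?W)"
    using fin assms by (intro card_image_le) auto
  also have "card ?W + card (Y \<times> ?W) = (card Y + 1) * card ?W"
    by (simp add: card_cartesian_product)
  also have "\<dots> \<le> (card Y + 1) * (card Y + 1) ^ j"
    using Suc.IH by (rule mult_left_mono) simp
  finally show ?case by simp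
qed

lemma finite_small_pairs: "finite X \<Longrightarrow> finite Z \<Longrightarrow> finite (small_pairs G s s' m X Z C)"
  by (rule finite_subset[of _ "Pow X \<times> Pow Z"]) (auto simp: small_pairs_def)

lemma choose_mult_le_choose_add: "(a choose s) * (b choose s') \<le> ((a + b) choose (s + s'))"
proof -
  have "(a choose s) * (b choose (s + s' - s)) \<le> (\<Sum>k\<le>s + s'. (a choose k) * (b choose (s + s' - k)))"
    by (rule member_le_sum[of s "{..s + s'}" "\<lambda>k. (a choose k) * (b choose (s + s' - k))"]) auto
  then show ?thesis by (simp add: vandermonde)
qed

text \<open>The containers are controlled only through \<open>card X + card Z\<close>, so the two
  binomial coefficients are merged, as one term of Vandermonde's sum.\<close>

lemma card_small_pairs_le:
  assumes "finite X" "finite Z"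
  shows "card (small_pairs G s s' m X Z C) \<le> ((card X + card Z) choose (s + s'))"
proof -
  let ?K = "\<lambda>V j. {A. A \<subseteq> V \<and> card A = j}"
  have "card (small_pairs G s s' m X Z C) \<le> card (?K X s \<times> ?K Z s')"
    using assms by (intro card_mono) (auto simp: small_pairs_def)
  also have "\<dots> = (card X choose s) * (card Z choose s')"
    using assms by (simp add: card_cartesian_product n_subsets)
  also have "\<dots> \<le> ((card X + card Z) choose (s + s'))"
    by (rule choose_mult_le_choose_add)
  finally show ?thesis .
qed

lemma card_sum_pairs:
  assumes "finite X" "finite Z"
  shows "card {(x, z). x \<in> X \<and> z \<in> Z \<and> P x z} = (\<Sum>z\<in>Z. card {x \<in> X. P x z})"
proof -
  have "card {(x, z). x \<in> X \<and> z \<in> Z \<and> P x z} = card (SIGMA z:Z. {x \<in> X. P x z})"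
    by (intro bij_betw_same_card[of prod.swap] bij_betw_imageI) (auto simp: inj_on_def image_iff)
  also have "\<dots> = (\<Sum>z\<in>Z. card {x \<in> X. P x z})"
    using assms by simp
  finally show ?thesis .
qed

section \<open>Fingerprints and the progress made in one round\<close>

context comm_group
begin

text \<open>\<open>S\<close> is as large as possible subject to
  \<open>card S * d <= card (C \<union> (S <#> F))\<close>. An element of \<open>A\<close> with
  \<open>d\<close> products outside this set could still be added; and the set lies in
  \<open>A <#> B\<close>, which gives \<open>card S * d <= m\<close>.\<close>

lemma greedy_fingerprint:
  assumes "finite A" "finite B" "B \<subseteq> carrier G" "A \<subseteq> carrier G" "F \<subseteq> B"
    and "C \<subseteq> A <#> B" "card (A <#> B) \<le> m" "0 < d"
  obtains S where "S \<subseteq> A" "card S * d \<le> m" "C \<union> (S <#> F) \<subseteq> A <#> B"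
    "A \<subseteq> shrink G d A F (C \<union> (S <#> F))"
proof -
  let ?P = "\<lambda>S. S \<subseteq> A \<and> card S * d \<le> card (C \<union> (S <#> F))"
  have P0: "?P {}" by simp
  have "\<forall>S. ?P S \<longrightarrow> card S < Suc (card A)" using assms(1) by (simp add: card_mono less_Suc_eq_le)
  from ex_has_greatest_nat[of ?P "{}" card, OF P0 this]
  obtain S where S: "?P S" and max: "\<And>T. ?P T \<Longrightarrow> card T \<le> card S" by (elim exE conjE) simp
  have fF: "finite F" "F \<subseteq> carrier G" using assms(2,3,5) finite_subset by auto
  have fAB: "finite (A <#> B)" using assms by (simp add: finite_set_mult)
  have sub: "C \<union> (T <#> F) \<subseteq> A <#> B" if "T \<subseteq> A" for T
    using mono_set_mult[OF that assms(5)] assms(6) by blast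
  let ?D = "C \<union> (S <#> F)"
  have fD: "finite ?D" using sub S fAB finite_subset by blast
  have "card {b \<in> F. a \<otimes> b \<notin> ?D} < d" if a: "a \<in> A" for a
  proof (rule ccontr)
    let ?T = "{b \<in> F. a \<otimes> b \<notin> ?D}"
    assume "\<not> card ?T < d"
    then have big: "d \<le> card ?T" by simp
    have "?T \<noteq> {}" using big \<open>0 < d\<close> by (metis card.empty not_le)
    then have aS: "a \<notin> S" by (auto simp: set_mult_def)
    have fS: "finite S" using S assms finite_subset by blast
    have "inj_on (\<lambda>b. a \<otimes> b) ?T" using a assms(4) fF(2) by (auto simp: inj_on_def subset_iff)
    then have "card ?D + card ?T = card (?D \<union> (\<lambda>b. a \<otimes> b) ` ?T)"
      using fD fF by (subst card_Un_disjoint) (auto simp: card_image)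
    also have "\<dots> \<le> card (C \<union> (insert a S <#> F))"
    proof (rule card_mono)
      show "finite (C \<union> (insert a S <#> F))"
        using sub[of "insert a S"] a S fAB finite_subset by blast
      show "?D \<union> (\<lambda>b. a \<otimes> b) ` ?T \<subseteq> C \<union> (insert a S <#> F)"
        by (auto simp: set_mult_def)
    qed
    finally have "card (insert a S) * d \<le> card (C \<union> (insert a S <#> F))"
      using S big aS fS by simp
    then have "card (insert a S) \<le> card S" using S a by (intro max) auto
    then show False using aS fS by simp
  qed
  then have "A \<subseteq> shrink G d A F ?D" by (auto simp: shrink_def)
  moreover have "card S * d \<le> m"
    using S assms(7) card_mono[OF fAB sub] by (meson le_trans)
  ultimately show thesis using that S sub by blast
qed

lemma card_pairs_into_le:
  assumes "finite D" "finite F" "X \<subseteq> carrier G" "F \<subseteq> carrier G"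
  shows "card {(x, b). x \<in> X \<and> b \<in> F \<and> x \<otimes> b \<in> D} \<le> card D * card F"
proof -
  have "inj_on (\<lambda>(x, b). (x \<otimes> b, b)) {(x, b). x \<in> X \<and> b \<in> F \<and> x \<otimes> b \<in> D}"
    using assms(3,4) by (auto simp: inj_on_def subset_iff)
  then have "card {(x, b). x \<in> X \<and> b \<in> F \<and> x \<otimes> b \<in> D} \<le> card (D \<times> F)"
    using assms by (intro card_inj_on_le) auto
  then show ?thesis by (simp add: card_cartesian_product)
qed

text \<open>Double counting: a surviving \<open>x\<close> has at least \<open>(k - 1) * d\<close> of
  its \<open>k * d\<close> products with \<open>F\<close> in \<open>C\<close>, while a product and
  its second factor determine \<open>x\<close>. If \<open>card C <= m\<close>, this cuts an
  arbitrary container down to little more than \<open>m\<close> elements.\<close>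

lemma card_shrink_le:
  assumes "finite X" "finite F" "finite C" "X \<subseteq> carrier G" "F \<subseteq> carrier G"
    and "card F = k * d" "0 < d"
  shows "card (shrink G d X F C) * (k - 1) \<le> card C * k"
proof -
  let ?X = "shrink G d X F C"
  have fX: "finite ?X" "?X \<subseteq> carrier G" using assms by (auto simp: shrink_def)
  have deg: "(k - 1) * d \<le> card {b \<in> F. x \<otimes> b \<in> C}" if "x \<in> ?X" for x
  proof -
    have "card {b \<in> F. x \<otimes> b \<in> C} + card {b \<in> F. x \<otimes> b \<notin> C} = card F"
      using assms(2) by (subst card_Un_disjoint[symmetric]) (auto intro!: arg_cong[of _ _ card])
    then show ?thesis using that assms by (auto simp: shrink_def diff_mult_distrib)
  qed
  have "card ?X * ((k - 1) * d) \<le> (\<Sum>x\<in>?X. card {b \<in> F. x \<otimes> b \<in> C})"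
    using sum_bounded_below[of ?X "(k - 1) * d" "\<lambda>x. card {b \<in> F. x \<otimes> b \<in> C}", OF deg] by simp
  also have "\<dots> = card {(b, x). b \<in> F \<and> x \<in> ?X \<and> x \<otimes> b \<in> C}"
    using card_sum_pairs[OF assms(2) fX(1), of "\<lambda>b x. x \<otimes> b \<in> C"] by simp
  also have "\<dots> = card {(x, b). x \<in> ?X \<and> b \<in> F \<and> x \<otimes> b \<in> C}"
    by (intro bij_betw_same_card[of prod.swap] bij_betw_imageI) (auto simp: inj_on_def image_iff)
  also have "\<dots> \<le> card C * (k * d)"
    using card_pairs_into_le[OF assms(3,2) fX(2) assms(5)] assms(6) by simp
  finally have "(card ?X * (k - 1)) * d \<le> (card C * k) * d" by (simp add: algebra_simps)
  then show ?thesis using \<open>0 < d\<close> by simp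
qed

text \<open>Either the container for \<open>A\<close> shrinks or the known part of the product set grows.\<close>

lemma shrink_progress:
  fixes \<theta> :: real
  assumes "finite X" "finite C'" "C \<subseteq> C'" "X \<subseteq> carrier G" "F \<subseteq> carrier G" "finite F"
    and cF: "card F = k * d" and "0 < d" "0 < k"
    and low: "F \<subseteq> low_degree G \<theta> X Z C"
  shows "\<theta> * card X * k \<le>
    (real (card X) - real (card (shrink G d X F C'))) * k + card X + (real (card C') - real (card C)) * k"
proof -
  let ?X = "shrink G d X F C'"
  have X: "?X \<subseteq> X" by (auto simp: shrink_def)
  \<comment> \<open>A pair with product outside \<open>C\<close> is of one of three kinds:
    \<open>x\<close> is removed; or \<open>x\<close> survives and the product is outside
    \<open>C'\<close>, fewer than \<open>d\<close> times for each \<open>x\<close>; or the product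
    is newly known. The low degrees in \<open>F\<close> bound the number of pairs from
    below.\<close>
  let ?Q = "{(x, b). x \<in> X \<and> b \<in> F \<and> x \<otimes> b \<notin> C}"
  let ?Q1 = "(X - ?X) \<times> F"
  let ?Q2 = "{(b, x). b \<in> F \<and> x \<in> ?X \<and> x \<otimes> b \<notin> C'}"
  let ?Q3 = "{(x, b). x \<in> X \<and> b \<in> F \<and> x \<otimes> b \<in> C' - C}"
  have fins: "finite ?Q1" "finite ?Q2" "finite ?Q3"
    using assms(1,6) X
    by (auto intro: finite_subset[of _ "X \<times> F"] finite_subset[of _ "F \<times> X"])
  have "\<theta> * card X * card F = (\<Sum>b\<in>F. \<theta> * card X)" by simp
  also have "\<dots> \<le> (\<Sum>b\<in>F. real (card {x \<in> X. x \<otimes> b \<notin> C}))"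
    using low by (intro sum_mono) (auto simp: low_degree_def)
  also have "\<dots> = real (card ?Q)"
    using card_sum_pairs[OF assms(1,6), of "\<lambda>x b. x \<otimes> b \<notin> C"] by simp
  also have "card ?Q \<le> card (?Q1 \<union> prod.swap ` ?Q2 \<union> ?Q3)"
    using fins by (intro card_mono) (auto simp: image_iff)
  also have "\<dots> \<le> card ?Q1 + card ?Q2 + card ?Q3"
    using card_Un_le[of "?Q1 \<union> prod.swap ` ?Q2" ?Q3] card_Un_le[of ?Q1 "prod.swap ` ?Q2"]
      card_image_le[OF fins(2), of prod.swap] by linarith
  also have "card ?Q1 = (card X - card ?X) * (k * d)"
    using X assms(1) cF by (simp add: card_cartesian_product card_Diff_subset finite_subset)
  also have "card ?Q2 \<le> card X * d"
  proof -
    have "card ?Q2 = (\<Sum>x\<in>?X. card {b \<in> F. x \<otimes> b \<notin> C'})"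
      using card_sum_pairs[of F ?X "\<lambda>b x. x \<otimes> b \<notin> C'"] assms(1,6) X finite_subset by blast
    also have "\<dots> \<le> card ?X * d"
      using sum_bounded_above[of ?X "\<lambda>x. card {b \<in> F. x \<otimes> b \<notin> C'}" d] by (auto simp: shrink_def)
    also have "\<dots> \<le> card X * d" using X assms(1) by (simp add: card_mono)
    finally show ?thesis .
  qed
  also have "card ?Q3 \<le> (card C' - card C) * (k * d)"
    using card_pairs_into_le[of "C' - C" F X] assms(2-6) cF
    by (simp add: card_Diff_subset finite_subset)
  finally have "\<theta> * card X * (k * d) \<le>
      real ((card X - card ?X) * (k * d) + card X * d + (card C' - card C) * (k * d))"
    using cF by simp
  also have "\<dots> = ((real (card X) - card ?X) * k + card X + (real (card C') - card C) * k) * d"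
    using card_mono[OF assms(1) X] card_mono[OF assms(2,3)]
    by (simp only: of_nat_add of_nat_mult of_nat_diff) (simp add: algebra_simps)
  finally have "(\<theta> * card X * k) * d \<le>
      ((real (card X) - card ?X) * k + card X + (real (card C') - card C) * k) * d"
    by (simp add: algebra_simps)
  then show ?thesis using \<open>0 < d\<close> by (simp add: mult_le_cancel_right)
qed

text \<open>At termination nearly all pairs have their product in \<open>C\<close>, so the Pollard
  sum at a level \<open>t\<close> near \<open>\<epsilon> * m\<close> is little more than
  \<open>t * m\<close>. If \<open>card X + card Z\<close> were too large,
  \<open>pollard_kneser\<close> would make it at least \<open>t * (1 + \<epsilon>) * m\<close>. When
  one container has fewer than \<open>\<epsilon> * m\<close> elements, the bound is
  immediate.\<close>

lemma card_container_le:
  fixes \<epsilon> \<beta> :: real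
  assumes "finite X" "finite Z" "finite C" "X \<subseteq> carrier G" "Z \<subseteq> carrier G"
    and "card C \<le> m" "0 < \<epsilon>" "\<epsilon> \<le> 1" "1 \<le> \<epsilon> * m"
    and sizes: "card X \<le> (1 + \<epsilon>) * m" "card Z \<le> (1 + \<epsilon>) * m"
    and sub: "\<And>H. subgroup H G \<Longrightarrow> finite H \<Longrightarrow> real (card H) \<le> (1 + \<epsilon>) * m \<Longrightarrow> real (card H) \<le> \<beta>"
    and "0 \<le> \<beta>"
    and final: "card X < \<epsilon> * m \<or> card Z < \<epsilon> * m \<or>
      card (low_degree G (\<epsilon>\<^sup>2 / 32) X Z C) < \<epsilon>\<^sup>2 / 32 * card Z"
  shows "real (card X) + real (card Z) \<le> (1 + 2 * \<epsilon>) * m + \<beta>"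
proof (rule ccontr)
  assume "\<not> ?thesis"
  then have large: "(1 + 2 * \<epsilon>) * m + \<beta> < real (card X) + real (card Z)" by simp
  have X: "\<epsilon> * m \<le> card X" and Z: "\<epsilon> * m \<le> card Z"
    using large sizes \<open>0 \<le> \<beta>\<close> by (auto simp: algebra_simps)
  \<comment> \<open>There are at most \<open>2 * \<theta> * card X * card Z\<close>, hence at most
    \<open>8 * \<theta> * m^2\<close>, exceptional pairs; this \<open>\<theta>\<close> makes that
    \<open>(\<epsilon> * m)^2 / 4\<close>.\<close>
  define \<theta> where "\<theta> = \<epsilon>\<^sup>2 / 32"
  let ?L = "low_degree G \<theta> X Z C"
  have L: "card ?L < \<theta> * card Z" using final X Z by (auto simp: \<theta>_def)
  have subL: "?L \<subseteq> Z" by (auto simp: low_degree_def)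
  have \<theta>: "0 \<le> \<theta>" by (simp add: \<theta>_def)
  \<comment> \<open>Rounding down keeps at least half of \<open>\<epsilon> * m\<close>, which is at
    least 1. The excess \<open>t * \<epsilon> * m\<close> is then at least
    \<open>(\<epsilon> * m)^2 / 2\<close>, twice what the exceptional pairs allow.\<close>
  define t where "t = nat \<lfloor>\<epsilon> * m\<rfloor>"
  have t: "real t \<le> \<epsilon> * m" "\<epsilon> * m \<le> 2 * real t" "0 < t"
  proof -
    have "1 \<le> \<lfloor>\<epsilon> * m\<rfloor>" using \<open>1 \<le> \<epsilon> * m\<close> by (simp add: le_floor_iff)
    then show "real t \<le> \<epsilon> * m" "\<epsilon> * m \<le> 2 * real t" "0 < t"
      unfolding t_def by linarith+
  qed
  let ?N = "card {(x, z). x \<in> X \<and> z \<in> Z \<and> x \<otimes> z \<notin> C}"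
  have "real ?N = (\<Sum>z\<in>Z. real (card {x \<in> X. x \<otimes> z \<notin> C}))"
    using card_sum_pairs[OF assms(1,2), of "\<lambda>x z. x \<otimes> z \<notin> C"] by simp
  also have "\<dots> = (\<Sum>z\<in>?L. real (card {x \<in> X. x \<otimes> z \<notin> C})) + (\<Sum>z\<in>Z - ?L. real (card {x \<in> X. x \<otimes> z \<notin> C}))"
    using sum.subset_diff[OF subL assms(2)] by (simp add: add.commute)
  also have "(\<Sum>z\<in>?L. real (card {x \<in> X. x \<otimes> z \<notin> C})) \<le> real (card ?L) * card X"
    using assms(1) by (intro sum_bounded_above) (auto intro!: card_mono)
  also have "\<dots> \<le> (\<theta> * card Z) * card X"
    using L by (intro mult_right_mono) auto
  also have "(\<Sum>z\<in>Z - ?L. real (card {x \<in> X. x \<otimes> z \<notin> C})) \<le> real (card (Z - ?L)) * (\<theta> * card X)"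
    by (intro sum_bounded_above) (auto simp: low_degree_def)
  also have "\<dots> \<le> real (card Z) * (\<theta> * card X)"
    using \<theta> assms(2) by (intro mult_right_mono) (auto intro!: card_mono)
  finally have "real ?N \<le> 2 * \<theta> * (real (card X) * real (card Z))" by (simp add: algebra_simps)
  also have "\<dots> \<le> 2 * \<theta> * ((2 * real m) * (2 * real m))"
  proof (intro mult_left_mono mult_mono)
    have "(1 + \<epsilon>) * real m \<le> 2 * real m" using \<open>\<epsilon> \<le> 1\<close> by (intro mult_right_mono) auto
    then show "real (card X) \<le> 2 * real m" "real (card Z) \<le> 2 * real m" using sizes by auto
  qed (use \<theta> in auto)
  also have "\<dots> = (\<epsilon> * m)\<^sup>2 / 4" by (simp add: \<theta>_def power2_eq_square)
  finally have N: "real ?N \<le> (\<epsilon> * m)\<^sup>2 / 4" .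
  \<comment> \<open>With \<open>L = (1 + \<epsilon>) * m\<close>, both terms of the minimum are at
    least \<open>L\<close>, by \<open>large\<close> and \<open>t <= \<epsilon> * m\<close>.\<close>
  have "(1 + \<epsilon>) * m \<le> min ((1 + \<epsilon>) * m) (card X + card Z - real t - \<beta>)"
    using large t by (auto simp: algebra_simps)
  then have "t * ((1 + \<epsilon>) * m) \<le> t * min ((1 + \<epsilon>) * m) (card X + card Z - real t - \<beta>)"
    by (intro mult_left_mono) auto
  also have "\<dots> \<le> pollard_sum G t X Z"
    using pollard_kneser[OF assms(1,2,4,5) t(3) _ _ sub \<open>0 \<le> \<beta>\<close>] X Z t by simp
  also have "\<dots> \<le> real (t * card C + ?N)"
    using pollard_sum_le[OF assms(1-3), of G t] by (simp only: of_nat_le_iff)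
  also have "\<dots> \<le> t * m + (\<epsilon> * m)\<^sup>2 / 4"
    using N assms(6) by (auto intro!: add_mono mult_left_mono)
  finally have "t * (\<epsilon> * m) \<le> (\<epsilon> * m)\<^sup>2 / 4" by (simp add: algebra_simps)
  moreover have "(\<epsilon> * m) / 2 * (\<epsilon> * m) \<le> t * (\<epsilon> * m)"
    using t \<open>1 \<le> \<epsilon> * m\<close> by (intro mult_right_mono) auto
  moreover have "0 < (\<epsilon> * m)\<^sup>2" using \<open>1 \<le> \<epsilon> * m\<close> by (intro zero_less_power) linarith
  ultimately show False by (simp add: power2_eq_square)
qed

end

section \<open>Iteration of the rounds\<close>

lemma card_UN_le_mult:
  assumes "finite I" "\<And>i. i \<in> I \<Longrightarrow> card (f i) \<le> c"
  shows "card (\<Union>i\<in>I. f i) \<le> card I * c"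
proof -
  have "card (\<Union>i\<in>I. f i) \<le> (\<Sum>i\<in>I. card (f i))" by (rule card_UN_le[OF assms(1)])
  also have "\<dots> \<le> card I * c"
    using sum_bounded_above[of I "\<lambda>i. card (f i)" c, OF assms(2)] by simp
  finally show ?thesis .
qed

lemma small_pairs_empty:
  assumes "finite X" "finite Z" "m < card C"
  shows "small_pairs G s s' m X Z C = {}"
proof -
  have False if "(A, B) \<in> small_pairs G s s' m X Z C" for A B
  proof -
    have AB: "A \<subseteq> X" "B \<subseteq> Z" "card (A <#>\<^bsub>G\<^esub> B) \<le> m" "C \<subseteq> A <#>\<^bsub>G\<^esub> B"
      using that by (auto simp: small_pairs_def)
    have "finite (A <#>\<^bsub>G\<^esub> B)"
      using AB(1,2) assms(1,2) by (intro finite_set_mult) (auto intro: finite_subset)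
    from card_mono[OF this AB(4)] AB(3) assms(3) show False by simp
  qed
  then show ?thesis by auto
qed

context comm_group
begin

lemma small_pairs_shrink:
  assumes "finite X" "finite Z" "X \<subseteq> carrier G" "Z \<subseteq> carrier G"
    and "(A, B) \<in> small_pairs G s s' m X Z C" "F \<subseteq> B" "0 < d"
  obtains S where "S \<subseteq> A" "card S * d \<le> m"
    "(A, B) \<in> small_pairs G s s' m (shrink G d X F (C \<union> (S <#> F))) Z (C \<union> (S <#> F))"
proof -
  have AB: "A \<subseteq> X" "B \<subseteq> Z" "card (A <#> B) \<le> m" "C \<subseteq> A <#> B" "card A = s" "card B = s'"
    using assms(5) by (auto simp: small_pairs_def)
  have fin: "finite A" "finite B" "A \<subseteq> carrier G" "B \<subseteq> carrier G"
    using AB(1,2) assms(1-4) finite_subset by auto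
  obtain S where S: "S \<subseteq> A" "card S * d \<le> m" "C \<union> (S <#> F) \<subseteq> A <#> B"
    "A \<subseteq> shrink G d A F (C \<union> (S <#> F))"
    using greedy_fingerprint[OF fin(1,2,4,3) assms(6) AB(4,3) assms(7)] by blast
  have "A \<subseteq> shrink G d X F (C \<union> (S <#> F))"
    using S(4) AB(1) by (auto simp: shrink_def)
  then have "(A, B) \<in> small_pairs G s s' m (shrink G d X F (C \<union> (S <#> F))) Z (C \<union> (S <#> F))"
    using AB S(3) by (simp add: small_pairs_def)
  with S show thesis using that by blast
qed

text \<open>Induction on the number \<open>r\<close> of rounds left, with potential
  \<open>card X + card Z + m - card C\<close>. A round lowers the potential by at least
  \<open>\<epsilon> ^ 3 * m / 64\<close> and branches into at most twice the square of
  \<open>card (small_subsets Y (k * d))\<close> classes; a class that stops is bounded by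
  \<open>card_container_le\<close>.\<close>

lemma card_small_pairs_containers:
  fixes \<epsilon> \<beta> :: real
  assumes Y: "finite Y" "Y \<subseteq> carrier G"
    and \<epsilon>: "0 < \<epsilon>" "\<epsilon> \<le> 1" "1 \<le> \<epsilon> * m"
    and d: "0 < d" "m \<le> d * d"
    and k: "64 \<le> \<epsilon>\<^sup>2 * k" "real (k * d) \<le> \<epsilon> ^ 3 * m / 64"
    and sub: "\<And>H. subgroup H G \<Longrightarrow> finite H \<Longrightarrow> real (card H) \<le> (1 + \<epsilon>) * m \<Longrightarrow> real (card H) \<le> \<beta>"
    and \<beta>: "0 \<le> \<beta>"
  shows "X \<subseteq> Y \<Longrightarrow> Z \<subseteq> Y \<Longrightarrow> finite C \<Longrightarrow> card X \<le> (1 + \<epsilon>) * m \<Longrightarrow> card Z \<le> (1 + \<epsilon>) * m \<Longrightarrow>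
    real (card X) + real (card Z) + m - real (card C) < r * (\<epsilon> ^ 3 * m / 64) \<Longrightarrow>
    card (small_pairs G s s' m X Z C)
      \<le> (2 * (card (small_subsets Y (k * d)))\<^sup>2) ^ r * (nat \<lfloor>(1 + 2 * \<epsilon>) * m + \<beta>\<rfloor> choose (s + s'))"
proof (induction r arbitrary: X Z C)
  case 0
  \<comment> \<open>A negative potential means more than \<open>m\<close> known products, which no
    pair allows.\<close>
  then have "real m < card C" by simp
  then have "small_pairs G s s' m X Z C = {}"
    using Y(1) "0.prems"(1,2) by (intro small_pairs_empty) (auto intro: finite_subset)
  then show ?case by simp
next
  case (Suc r)
  let ?W = "card (small_subsets Y (k * d))"
  let ?N = "nat \<lfloor>(1 + 2 * \<epsilon>) * m + \<beta>\<rfloor> choose (s + s')"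
  let ?bd = "(2 * ?W\<^sup>2) ^ r * ?N"
  define \<theta> where "\<theta> = \<epsilon>\<^sup>2 / 32"
  let ?L = "low_degree G \<theta> X Z C"
  have fin: "finite X" "finite Z" "X \<subseteq> carrier G" "Z \<subseteq> carrier G"
    using Suc.prems(1,2) Y finite_subset by auto
  have "{} \<in> small_subsets Y (k * d)" by (simp add: small_subsets_def)
  then have W: "1 \<le> ?W" using finite_small_subsets[OF Y(1)] by (metis One_nat_def Suc_leI card_gt_0_iff empty_iff)
  have k0: "0 < k" using k(1) by (cases "k = 0") auto
  have subL: "?L \<subseteq> Z" by (auto simp: low_degree_def)
  show ?case
  proof (cases "card X < \<epsilon> * m \<or> card Z < \<epsilon> * m \<or> card ?L < \<theta> * card Z \<or> m < card C")
    case True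
    have "card (small_pairs G s s' m X Z C) \<le> ?N"
    proof (cases "m < card C")
      case True
      then have "small_pairs G s s' m X Z C = {}"
        using fin(1,2) by (intro small_pairs_empty)
      then show ?thesis by simp
    next
      case False
      then have "real (card X) + real (card Z) \<le> (1 + 2 * \<epsilon>) * m + \<beta>"
        using True by (intro card_container_le[OF fin(1,2) Suc.prems(3) fin(3,4) _ \<epsilon> Suc.prems(4,5) sub \<beta>])
          (auto simp: \<theta>_def)
      then have "card X + card Z \<le> nat \<lfloor>(1 + 2 * \<epsilon>) * m + \<beta>\<rfloor>"
        by (simp add: le_nat_floor)
      then have "((card X + card Z) choose (s + s')) \<le> ?N" by (rule binomial_right_mono)
      with card_small_pairs_le[OF fin(1,2)] show ?thesis by (rule le_trans)
    qed
    also have "?N \<le> (2 * ?W\<^sup>2) ^ Suc r * ?N"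
    proof -
      have "1 \<le> (2 * ?W\<^sup>2) ^ Suc r" using W by (intro one_le_power) simp
      then have "1 * ?N \<le> (2 * ?W\<^sup>2) ^ Suc r * ?N" by (rule mult_right_mono) simp
      then show ?thesis by simp
    qed
    finally show ?thesis .
  next
    case False
    then have big: "\<epsilon> * m \<le> card X" "\<epsilon> * m \<le> card Z" "\<theta> * card Z \<le> card ?L" by auto
    \<comment> \<open>Either \<open>B\<close> has fewer than \<open>k * d\<close> elements in the
      low-degree set, which are guessed as \<open>F\<close> while the rest of that set is deleted
      from \<open>Z\<close>; or \<open>k * d\<close> elements of \<open>B\<close> in that set serve
      as the fingerprint \<open>F\<close>.\<close>
    let ?F1 = "{F. F \<subseteq> ?L \<and> card F < k * d}"
    let ?F2 = "small_subsets Y (k * d) \<times> {F. F \<subseteq> ?L \<and> card F = k * d}"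
    let ?P1 = "\<lambda>F. small_pairs G s s' m X (Z - ?L \<union> F) C"
    let ?P2 = "\<lambda>(S, F). small_pairs G s s' m (shrink G d X F (C \<union> (S <#> F))) Z (C \<union> (S <#> F))"
    have cover: "small_pairs G s s' m X Z C \<subseteq> (\<Union>F\<in>?F1. ?P1 F) \<union> (\<Union>p\<in>?F2. ?P2 p)"
    proof (rule subsetI, rule ccontr)
      fix p assume p: "p \<in> small_pairs G s s' m X Z C"
        and n: "p \<notin> (\<Union>F\<in>?F1. ?P1 F) \<union> (\<Union>p\<in>?F2. ?P2 p)"
      obtain A B where AB: "p = (A, B)" by force
      show False
      proof (cases "card (B \<inter> ?L) < k * d")
        case True
        then have "B \<inter> ?L \<in> ?F1" by simp
        moreover have "p \<in> ?P1 (B \<inter> ?L)" using p by (auto simp: AB small_pairs_def)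
        ultimately show False using n by blast
      next
        case False
        then have "k * d \<le> card (B \<inter> ?L)" by simp
        then obtain F where F: "F \<subseteq> B \<inter> ?L" "card F = k * d"
          by (rule obtain_subset_with_card_n)
        then have FB: "F \<subseteq> B" by blast
        obtain S where S: "S \<subseteq> A" "card S * d \<le> m"
          "(A, B) \<in> small_pairs G s s' m (shrink G d X F (C \<union> (S <#> F))) Z (C \<union> (S <#> F))"
          by (rule small_pairs_shrink[OF fin p[unfolded AB] FB d(1)])
        \<comment> \<open>Because \<open>m <= d * d\<close>, \<open>S\<close> has at most
          \<open>d\<close> elements, so the same family of small subsets covers both parts of the
          fingerprint.\<close>
        have "card S * d \<le> d * d" using S(2) d(2) by (rule le_trans)
        then have "card S \<le> d" using d(1) by (simp only: mult_le_cancel2)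
        also have "d \<le> k * d" using k0 by simp
        finally have "S \<in> small_subsets Y (k * d)"
          using S(1) p Suc.prems(1) by (auto simp: small_subsets_def AB small_pairs_def)
        then have "(S, F) \<in> ?F2" using F by simp
        moreover have "p \<in> ?P2 (S, F)" using S(3) by (simp add: AB)
        ultimately show False using n by blast
      qed
    qed
    \<comment> \<open>The losses of potential in the two branches: half of
      \<open>\<theta> * card X\<close> when a fingerprint is used, and
      \<open>\<theta> * card Z\<close> when low-degree elements are deleted, of which at most
      \<open>k * d\<close> is given back.\<close>
    have step: "\<epsilon> ^ 3 * m / 64 \<le> \<theta> / 2 * card X" "\<epsilon> ^ 3 * m / 32 \<le> \<theta> * card Z"
      using mult_left_mono[OF big(1), of "\<theta> / 2"] mult_left_mono[OF big(2), of \<theta>]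
      by (auto simp: \<theta>_def power2_eq_square power3_eq_cube)
    have c1: "card (?P1 F) \<le> ?bd" if F: "F \<in> ?F1" for F
    proof (rule Suc.IH)
      have fF: "finite ?L" "F \<subseteq> ?L" "F \<subseteq> Z" using F subL fin(2) finite_subset by auto
      have le: "card (Z - ?L \<union> F) \<le> card Z" using fF fin(2) by (intro card_mono) auto
      show "Z - ?L \<union> F \<subseteq> Y" using fF Suc.prems(2) by auto
      show "card (Z - ?L \<union> F) \<le> (1 + \<epsilon>) * m" using le Suc.prems(5) by linarith
      have "card (Z - ?L \<union> F) \<le> card (Z - ?L) + card F" by (rule card_Un_le)
      also have "card (Z - ?L) = card Z - card ?L" using subL fF(1) by (simp add: card_Diff_subset)
      finally have "card (Z - ?L \<union> F) + card ?L \<le> card Z + k * d"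
        using F card_mono[OF fin(2) subL] unfolding mem_Collect_eq by linarith
      then have "real (card (Z - ?L \<union> F)) \<le> real (card Z) - card ?L + k * d"
        by (simp flip: of_nat_add of_nat_mult)
      also have "\<dots> \<le> card Z - \<epsilon> ^ 3 * m / 64"
        using step(2) big(3) k(2) by linarith
      finally show "real (card X) + real (card (Z - ?L \<union> F)) + m - real (card C) < r * (\<epsilon> ^ 3 * m / 64)"
        using Suc.prems(6) by (simp add: algebra_simps)
    qed (use Suc.prems in auto)
    have c2: "card (?P2 p) \<le> ?bd" if p: "p \<in> ?F2" for p
    proof -
      obtain S F where SF: "p = (S, F)" "S \<subseteq> Y" "F \<subseteq> ?L" "card F = k * d"
        using p by (auto simp: small_subsets_def)
      let ?C = "C \<union> (S <#> F)" and ?X = "shrink G d X F (C \<union> (S <#> F))"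
      have fSF: "finite S" "finite F" "F \<subseteq> carrier G"
        using SF(2,3) Y(1) subL fin(2,4) by (blast intro: finite_subset)+
      have fC: "finite ?C" using fSF Suc.prems(3) by (simp add: finite_set_mult)
      have subX: "?X \<subseteq> X" by (auto simp: shrink_def)
      have "\<theta> * card X * k \<le> (real (card X) - real (card ?X)) * k + card X + (real (card ?C) - real (card C)) * k"
        using fSF fin SF d k0 fC by (intro shrink_progress[where Z = Z]) auto
      \<comment> \<open>Since \<open>\<theta> / 2 * k = \<epsilon>^2 * k / 64 >= 1\<close>, the
        error term \<open>card X\<close> costs at most half of the gain.\<close>
      moreover have "card X \<le> \<theta> / 2 * card X * k"
        using mult_right_mono[OF k(1), of "real (card X)"] by (simp add: \<theta>_def algebra_simps)
      ultimately have "(\<theta> / 2 * card X) * k \<le> (real (card X) - card ?X + real (card ?C) - card C) * k"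
        by (simp add: algebra_simps)
      then have prog: "\<theta> / 2 * card X \<le> real (card X) - card ?X + real (card ?C) - card C"
        using k0 by simp
      have "card (small_pairs G s s' m ?X Z ?C) \<le> ?bd"
      proof (rule Suc.IH)
        have "card ?X \<le> card X" using subX fin(1) by (simp add: card_mono)
        then show "card ?X \<le> (1 + \<epsilon>) * m" using Suc.prems(4) by linarith
        show "real (card ?X) + real (card Z) + m - real (card ?C) < r * (\<epsilon> ^ 3 * m / 64)"
          using prog step(1) Suc.prems(6) by (simp add: algebra_simps)
      qed (use Suc.prems subX fC in auto)
      then show ?thesis by (simp add: SF(1))
    qed
    have LY: "?L \<subseteq> Y" using subL Suc.prems(2) by blast
    have f: "finite ?F1" "finite ?F2"
      using fin(2) subL finite_small_subsets[OF Y(1)]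
      by (auto intro: finite_subset[of _ "Pow Z"])
    have n1: "card ?F1 \<le> ?W" "card {F. F \<subseteq> ?L \<and> card F = k * d} \<le> ?W"
      using LY by (intro card_mono finite_small_subsets Y(1); auto simp: small_subsets_def)+
    have "card (small_pairs G s s' m X Z C) \<le> card ((\<Union>F\<in>?F1. ?P1 F) \<union> (\<Union>p\<in>?F2. ?P2 p))"
    proof (intro card_mono cover finite_UnI finite_UN_I f)
      show "finite (?P1 F)" if "F \<in> ?F1" for F
        using that subL fin(1,2) by (intro finite_small_pairs) (auto intro: finite_subset)
      show "finite (?P2 p)" if "p \<in> ?F2" for p
        using fin(1,2) by (cases p) (auto intro!: finite_small_pairs simp: shrink_def)
    qed
    also have "\<dots> \<le> card (\<Union>F\<in>?F1. ?P1 F) + card (\<Union>p\<in>?F2. ?P2 p)" by (rule card_Un_le)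
    also have "\<dots> \<le> card ?F1 * ?bd + card ?F2 * ?bd"
      by (intro add_mono card_UN_le_mult f c1 c2)
    also have "\<dots> \<le> ?W\<^sup>2 * ?bd + ?W\<^sup>2 * ?bd"
    proof (intro add_mono mult_right_mono)
      show "card ?F1 \<le> ?W\<^sup>2" using n1(1) W by (simp add: power2_eq_square le_trans)
      show "card ?F2 \<le> ?W\<^sup>2"
        using n1(2) by (simp add: card_cartesian_product power2_eq_square)
    qed auto
    also have "\<dots> = (2 * ?W\<^sup>2) ^ Suc r * ?N" by simp
    finally show ?thesis .
  qed
qed

text \<open>By commutativity, the preliminary shrinking of the first container can be applied to the
  second as well.\<close>

lemma card_small_pairs_swap:
  assumes "X \<subseteq> carrier G" "Z \<subseteq> carrier G"
  shows "card (small_pairs G s s' m X Z C) = card (small_pairs G s' s m Z X C)"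
proof -
  have comm: "B <#> A = A <#> B" if "A \<subseteq> X" "B \<subseteq> Z" for A B
  proof -
    have "B <#> A = (\<Union>b\<in>B. \<Union>a\<in>A. {a \<otimes> b})"
      unfolding set_mult_def using that assms
      by (intro SUP_cong refl) (simp add: m_comm subset_iff)
    also have "\<dots> = A <#> B" by (auto simp: set_mult_def)
    finally show ?thesis .
  qed
  have iff: "(B, A) \<in> small_pairs G s' s m Z X C \<longleftrightarrow> (A, B) \<in> small_pairs G s s' m X Z C" for A B
    using comm[of A B] by (cases "A \<subseteq> X \<and> B \<subseteq> Z") (auto simp: small_pairs_def)
  have "small_pairs G s' s m Z X C = prod.swap ` small_pairs G s s' m X Z C"
  proof (rule Set.set_eqI)
    fix p :: "'a set \<times> 'a set"
    show "p \<in> small_pairs G s' s m Z X C \<longleftrightarrow> p \<in> prod.swap ` small_pairs G s s' m X Z C"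
      using iff[of "fst p" "snd p"] by (cases p) (auto simp: iff)
  qed
  then show ?thesis by (simp add: card_image)
qed

text \<open>A preliminary round for a container of arbitrary size: any \<open>k * d\<close> elements
  of \<open>B\<close> serve as \<open>F\<close>, and \<open>card_shrink_le\<close> bounds the new
  container. Classes with more than \<open>m\<close> known products are empty, so
  \<open>bound\<close> is asked only for the others.\<close>

lemma card_small_pairs_shrink_le:
  assumes Y: "finite Y" "Y \<subseteq> carrier G"
    and XZ: "X \<subseteq> Y" "Z \<subseteq> Y" "finite C"
    and d: "0 < d" "m \<le> d * d" and k: "0 < k" "k * d \<le> s'"
    and bound: "\<And>X' C'. X' \<subseteq> X \<Longrightarrow> finite C' \<Longrightarrow> card C' \<le> m \<Longrightarrow> card X' * (k - 1) \<le> m * k \<Longrightarrow>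
      card (small_pairs G s s' m X' Z C') \<le> c"
  shows "card (small_pairs G s s' m X Z C) \<le> (card (small_subsets Y (k * d)))\<^sup>2 * c"
proof -
  have fin: "finite X" "finite Z" "X \<subseteq> carrier G" "Z \<subseteq> carrier G"
    using XZ(1,2) Y finite_subset by auto
  let ?I = "small_subsets Y (k * d) \<times> {F. F \<subseteq> Z \<and> card F = k * d}"
  let ?P = "\<lambda>(S, F). small_pairs G s s' m (shrink G d X F (C \<union> (S <#> F))) Z (C \<union> (S <#> F))"
  have cover: "small_pairs G s s' m X Z C \<subseteq> (\<Union>p\<in>?I. ?P p)"
  proof
    fix p assume p: "p \<in> small_pairs G s s' m X Z C"
    obtain A B where AB: "p = (A, B)" by force
    have B: "A \<subseteq> X" "B \<subseteq> Z" "card B = s'" using p by (auto simp: AB small_pairs_def)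
    have "k * d \<le> card B" using k(2) B(3) by simp
    then obtain F where F: "F \<subseteq> B" "card F = k * d"
      by (rule obtain_subset_with_card_n)
    obtain S where S: "S \<subseteq> A" "card S * d \<le> m"
      "(A, B) \<in> small_pairs G s s' m (shrink G d X F (C \<union> (S <#> F))) Z (C \<union> (S <#> F))"
      by (rule small_pairs_shrink[OF fin p[unfolded AB] F(1) d(1)])
    have "card S * d \<le> d * d" using S(2) d(2) by (rule le_trans)
    then have "card S \<le> d" using d(1) by (simp only: mult_le_cancel2)
    also have "d \<le> k * d" using k(1) by simp
    finally have "S \<in> small_subsets Y (k * d)"
      using S(1) B(1) XZ(1) by (auto simp: small_subsets_def)
    then have "(S, F) \<in> ?I" using F B by auto
    moreover have "p \<in> ?P (S, F)" using S(3) by (simp add: AB)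
    ultimately show "p \<in> (\<Union>p\<in>?I. ?P p)" by (rule UN_I)
  qed
  have fI: "finite ?I"
    using fin(2) finite_small_subsets[OF Y(1)] by (auto intro: finite_subset[of _ "Pow Z"])
  have "card (?P p) \<le> c" if p: "p \<in> ?I" for p
  proof -
    obtain S F where SF: "p = (S, F)" "S \<subseteq> Y" "F \<subseteq> Z" "card F = k * d"
      using p by (auto simp: small_subsets_def)
    let ?C = "C \<union> (S <#> F)" and ?X = "shrink G d X F (C \<union> (S <#> F))"
    have fSF: "finite S" "finite F" "F \<subseteq> carrier G"
      using SF(2,3) Y(1) fin(2,4) by (blast intro: finite_subset)+
    have fC: "finite ?C" using fSF XZ(3) by (simp add: finite_set_mult)
    have subX: "?X \<subseteq> X" by (auto simp: shrink_def)
    have "card (small_pairs G s s' m ?X Z ?C) \<le> c"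
    proof (cases "card ?C \<le> m")
      case True
      have "card ?X * (k - 1) \<le> card ?C * k"
        using card_shrink_le[OF fin(1) fSF(2) fC fin(3) fSF(3) SF(4) d(1)] .
      also have "\<dots> \<le> m * k" using True by simp
      finally show ?thesis using bound[OF subX fC True] by blast
    next
      case False
      then have "small_pairs G s s' m ?X Z ?C = {}"
        using fin(1,2) subX by (intro small_pairs_empty) (auto intro: finite_subset)
      then show ?thesis by simp
    qed
    then show ?thesis by (simp add: SF(1))
  qed
  then have le: "card (\<Union>p\<in>?I. ?P p) \<le> card ?I * c" by (rule card_UN_le_mult[OF fI])
  have n: "card {F. F \<subseteq> Z \<and> card F = k * d} \<le> card (small_subsets Y (k * d))"
    using XZ(2) by (intro card_mono finite_small_subsets Y(1)) (auto simp: small_subsets_def)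
  have fU: "finite (\<Union>p\<in>?I. ?P p)"
  proof (rule finite_UN_I[OF fI])
    show "finite (?P p)" for p
      using fin(1,2) by (cases p) (auto intro!: finite_small_pairs simp: shrink_def)
  qed
  have "card (small_pairs G s s' m X Z C) \<le> card ?I * c"
    using card_mono[OF fU cover] le by (rule le_trans)
  also have "card ?I \<le> (card (small_subsets Y (k * d)))\<^sup>2"
    using n by (simp add: card_cartesian_product power2_eq_square)
  finally show ?thesis by simp
qed

text \<open>Two preliminary rounds, one of them with the roles of the sets exchanged, cut both
  containers from \<open>Y\<close> to at most \<open>(1 + \<epsilon>) * m\<close> elements;
  \<open>r\<close> rounds of the main iteration finish. Each preliminary round is charged one more
  factor, whence \<open>r + 2\<close>.\<close>

lemma card_small_pairs_le_choose:
  fixes \<epsilon> \<beta> :: real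
  assumes Y: "finite Y" "Y \<subseteq> carrier G"
    and \<epsilon>: "0 < \<epsilon>" "\<epsilon> \<le> 1" "1 \<le> \<epsilon> * m"
    and d: "0 < d" "m \<le> d * d"
    and k: "64 \<le> \<epsilon>\<^sup>2 * k" "real (k * d) \<le> \<epsilon> ^ 3 * m / 64" "k * d \<le> s" "k * d \<le> s'"
    and sub: "\<And>H. subgroup H G \<Longrightarrow> finite H \<Longrightarrow> real (card H) \<le> (1 + \<epsilon>) * m \<Longrightarrow> real (card H) \<le> \<beta>"
    and \<beta>: "0 \<le> \<beta>"
    and r: "320 < r * \<epsilon> ^ 3"
  shows "card (small_pairs G s s' m Y Y {})
      \<le> (2 * (card Y + 1) ^ (2 * k * d)) ^ (r + 2) * (nat \<lfloor>(1 + 2 * \<epsilon>) * m + \<beta>\<rfloor> choose (s + s'))"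
proof -
  let ?W = "card (small_subsets Y (k * d))"
  let ?N = "nat \<lfloor>(1 + 2 * \<epsilon>) * m + \<beta>\<rfloor> choose (s + s')"
  let ?bd = "(2 * ?W\<^sup>2) ^ r * ?N"
  have k0: "0 < k" using k(1) by (cases "k = 0") auto
  have m0: "0 < m" using \<epsilon> by (cases "m = 0") auto
  \<comment> \<open>\<open>k / (k - 1) <= 1 + \<epsilon>\<close> because
    \<open>\<epsilon> * k >= 2\<close> and \<open>\<epsilon> <= 1\<close>.\<close>
  have size: "real (card V) \<le> (1 + \<epsilon>) * m" if V: "card V * (k - 1) \<le> m * k" for V :: "'a set"
  proof -
    have "64 \<le> \<epsilon> * (\<epsilon> * k)" using k(1) by (simp add: power2_eq_square)
    also have "\<dots> \<le> 1 * (\<epsilon> * k)" using \<epsilon> by (intro mult_right_mono) auto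
    finally have \<epsilon>k: "2 \<le> \<epsilon> * k" by simp
    then have "2 \<le> k" using \<epsilon>(1,2) mult_right_mono[of \<epsilon> 1 "real k"] by simp
    have "real (card V) * (real k - 1) = real (card V * (k - 1))" using k0 by (simp add: of_nat_diff)
    also have "\<dots> \<le> real (m * k)" using V by (simp only: of_nat_le_iff)
    also have "\<dots> = real m * real k" by simp
    also have "\<dots> \<le> real m * ((1 + \<epsilon>) * (real k - 1))"
      using \<epsilon>k \<epsilon>(2) by (intro mult_left_mono) (auto simp: algebra_simps)
    finally have "real (card V) * (real k - 1) \<le> ((1 + \<epsilon>) * m) * (real k - 1)"
      by (simp add: algebra_simps)
    then show ?thesis using \<open>2 \<le> k\<close> by (simp add: mult_le_cancel_right)
  qed
  have two: "card (small_pairs G s s' m X Z C) \<le> ?bd"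
    if X: "X \<subseteq> Y" "card X * (k - 1) \<le> m * k" and Z: "Z \<subseteq> Y" "card Z * (k - 1) \<le> m * k"
      and C: "finite C" for X Z C
  proof (rule card_small_pairs_containers[OF Y \<epsilon> d k(1,2) sub \<beta> X(1) Z(1) C size[OF X(2)] size[OF Z(2)]])
    \<comment> \<open>The initial potential is at most \<open>2 m + 2 m + m\<close>, and
      \<open>320 = 5 * 64\<close>.\<close>
    have "(1 + \<epsilon>) * m \<le> 2 * real m" using \<epsilon>(2) by (intro mult_right_mono) auto
    then have "real (card X) + real (card Z) + m - real (card C) \<le> 5 * real m"
      using size[OF X(2)] size[OF Z(2)] by linarith
    also have "\<dots> < r * \<epsilon> ^ 3 / 64 * m"
      using r m0 by (intro mult_strict_right_mono) auto
    finally show "real (card X) + real (card Z) + m - real (card C) < r * (\<epsilon> ^ 3 * m / 64)"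
      by (simp add: algebra_simps)
  qed
  have one: "card (small_pairs G s s' m X Y C) \<le> ?W\<^sup>2 * ?bd"
    if X: "X \<subseteq> Y" "card X * (k - 1) \<le> m * k" and C: "finite C" for X C
  proof -
    have "card (small_pairs G s' s m Y X C) \<le> ?W\<^sup>2 * ?bd"
    proof (rule card_small_pairs_shrink_le[OF Y subset_refl X(1) C d k0 k(3)])
      fix Z C' :: "'a set" assume Z: "Z \<subseteq> Y" "finite C'" "card Z * (k - 1) \<le> m * k"
      have "card (small_pairs G s' s m Z X C') = card (small_pairs G s s' m X Z C')"
        using X(1) Z(1) Y(2) by (intro card_small_pairs_swap) auto
      also have "\<dots> \<le> ?bd" by (rule two[OF X Z(1,3,2)])
      finally show "card (small_pairs G s' s m Z X C') \<le> ?bd" .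
    qed
    moreover have "card (small_pairs G s s' m X Y C) = card (small_pairs G s' s m Y X C)"
      using X(1) Y(2) by (intro card_small_pairs_swap) auto
    ultimately show ?thesis by simp
  qed
  have "card (small_pairs G s s' m Y Y {}) \<le> ?W\<^sup>2 * (?W\<^sup>2 * ?bd)"
    by (rule card_small_pairs_shrink_le[OF Y subset_refl subset_refl finite.emptyI d k0 k(4) one])
  also have "\<dots> \<le> (2 * ?W\<^sup>2) * ((2 * ?W\<^sup>2) * ?bd)"
    by (intro mult_mono) auto
  also have "\<dots> = (2 * ?W\<^sup>2) ^ (r + 2) * ?N" by (simp add: power_add power2_eq_square)
  also have "\<dots> \<le> (2 * ((card Y + 1) ^ (k * d))\<^sup>2) ^ (r + 2) * ?N"
    using card_small_subsets_le[OF Y(1), of "k * d"]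
    by (intro mult_right_mono power_mono mult_left_mono) auto
  also have "((card Y + 1) ^ (k * d))\<^sup>2 = (card Y + 1) ^ (2 * k * d)"
    by (simp add: power_mult[symmetric] ac_simps)
  finally show ?thesis .
qed

end

section \<open>Binomial coefficients with real upper entry\<close>

lemma gbinomial_eq_prod:
  fixes x :: real
  shows "(x gchoose n) = (\<Prod>i<n. x - real i) / fact n"
  by (simp add: gbinomial_prod_rev atLeast0LessThan)

lemma gbinomial_real_nonneg:
  fixes x :: real
  assumes "real n \<le> x"
  shows "0 \<le> (x gchoose n)"
  unfolding gbinomial_eq_prod using assms by (intro divide_nonneg_pos prod_nonneg) auto

lemma gbinomial_real_mono:
  fixes x y :: real
  assumes "real n \<le> x" "x \<le> y"
  shows "(x gchoose n) \<le> (y gchoose n)"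
  unfolding gbinomial_eq_prod using assms by (intro divide_right_mono prod_mono) auto

lemma gbinomial_real_ge_one:
  fixes x :: real
  assumes "real n \<le> x"
  shows "1 \<le> (x gchoose n)"
  using gbinomial_real_mono[OF order_refl assms] by (simp flip: binomial_gbinomial)

text \<open>Telescopes, since
  \<open>1 / sqrt (n + 1) <= 2 * sqrt (n + 1) - 2 * sqrt n\<close>.\<close>

lemma sum_inverse_sqrt_le: "(\<Sum>i<n. 1 / sqrt (real (Suc i))) \<le> 2 * sqrt (real n)"
proof (induction n)
  case (Suc n)
  define a b where "a = sqrt (real n)" and "b = sqrt (real (Suc n))"
  have ab: "0 \<le> a" "0 < b" "a \<le> b" "b * b = a * a + 1" by (auto simp: a_def b_def)
  have "2 * a * b \<le> a * a + b * b" using sum_squares_bound[of a b] by (simp add: power2_eq_square)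
  then have "1 \<le> (2 * b - 2 * a) * b" using ab by (simp add: algebra_simps)
  then have "1 / b \<le> 2 * b - 2 * a" using ab by (simp add: pos_divide_le_eq)
  then show ?case using Suc by (simp add: a_def b_def)
qed simp

text \<open>The factor with index \<open>i\<close> grows at most by \<open>1 + y^2\<close>, where
  \<open>y^2 = c * n / (n - i)\<close>. Bounding this by \<open>exp (2 * y)\<close> rather than by
  \<open>exp (y^2)\<close> keeps the exponent linear in \<open>n\<close>, uniformly in
  \<open>M >= n\<close>; summing \<open>y^2\<close> would cost a logarithm.\<close>

lemma gbinomial_scale_le:
  fixes M c :: real
  assumes "real n \<le> M" "0 \<le> c"
  shows "((1 + c) * M gchoose n) \<le> exp (4 * sqrt c * n) * (M gchoose n)"
proof -
  have step: "(1 + c) * M - real i \<le> exp (2 * sqrt (c * n) * (1 / sqrt (real (n - i)))) * (M - real i)"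
    if i: "i < n" for i
  proof -
    define y where "y = sqrt (c * n) / sqrt (real (n - i))"
    have pos: "0 < real (n - i)" "0 < M - real i" using i assms by auto
    have y0: "0 \<le> y" using assms by (simp add: y_def)
    have "y\<^sup>2 = c * n / real (n - i)" using assms pos by (simp add: y_def power_divide)
    then have y2: "y\<^sup>2 * (real n - real i) = c * n" using pos i by (simp add: of_nat_diff)
    \<comment> \<open>This is \<open>M / (M - i) <= n / (n - i)\<close>, multiplied out; it holds
      because \<open>n <= M\<close>.\<close>
    have "c * M * (real n - real i) \<le> c * n * (M - real i)"
      using mult_left_mono[OF assms(1), of "c * real i"] assms(2) by (simp add: algebra_simps)
    also have "\<dots> = y\<^sup>2 * (M - real i) * (real n - real i)" using y2 by (simp add: algebra_simps)
    finally have cM: "c * M \<le> y\<^sup>2 * (M - real i)" using i by (simp add: mult_le_cancel_right)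
    have "(1 + c) * M - real i = (M - real i) + c * M" by (simp add: algebra_simps)
    also have "\<dots> \<le> (1 + y\<^sup>2) * (M - real i)" using cM by (simp add: algebra_simps)
    also have "\<dots> \<le> (1 + y)\<^sup>2 * (M - real i)"
      using y0 pos by (intro mult_right_mono) (auto simp: power2_sum)
    also have "\<dots> \<le> (exp y)\<^sup>2 * (M - real i)"
      using y0 pos by (intro mult_right_mono power_mono exp_ge_add_one_self) auto
    also have "(exp y)\<^sup>2 = exp (2 * y)" by (simp add: exp_double)
    finally show ?thesis by (simp add: y_def)
  qed
  have "(\<Sum>i<n. 1 / sqrt (real (n - i))) = (\<Sum>i<n. 1 / sqrt (real (Suc (n - Suc i))))"
    by (intro sum.cong) (auto simp: Suc_diff_Suc)
  also have "\<dots> = (\<Sum>i<n. 1 / sqrt (real (Suc i)))"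
    by (rule sum.nat_diff_reindex[of "\<lambda>i. 1 / sqrt (real (Suc i))"])
  also have "\<dots> \<le> 2 * sqrt (real n)" by (rule sum_inverse_sqrt_le)
  finally have S: "(\<Sum>i<n. 1 / sqrt (real (n - i))) \<le> 2 * sqrt (real n)" .
  have "2 * sqrt (c * n) * (\<Sum>i<n. 1 / sqrt (real (n - i))) \<le> 2 * sqrt (c * n) * (2 * sqrt (real n))"
    using assms S by (intro mult_left_mono) auto
  also have "\<dots> = 4 * sqrt c * n" by (simp add: real_sqrt_mult)
  finally have E: "2 * sqrt (c * n) * (\<Sum>i<n. 1 / sqrt (real (n - i))) \<le> 4 * sqrt c * n" .
  have "(\<Prod>i<n. (1 + c) * M - real i)
      \<le> (\<Prod>i<n. exp (2 * sqrt (c * n) * (1 / sqrt (real (n - i)))) * (M - real i))"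
  proof (intro prod_mono conjI)
    fix i assume i: "i \<in> {..<n}"
    have "0 \<le> c * M" using assms by (intro mult_nonneg_nonneg) auto
    moreover have "real i \<le> M" using i assms by auto
    ultimately show "0 \<le> (1 + c) * M - real i" by (simp add: distrib_right)
    show "(1 + c) * M - real i \<le> exp (2 * sqrt (c * n) * (1 / sqrt (real (n - i)))) * (M - real i)"
      using i step by simp
  qed
  also have "\<dots> = exp (2 * sqrt (c * n) * (\<Sum>i<n. 1 / sqrt (real (n - i)))) * (\<Prod>i<n. M - real i)"
    unfolding prod.distrib sum_distrib_left by (simp add: exp_sum)
  also have "\<dots> \<le> exp (4 * sqrt c * n) * (\<Prod>i<n. M - real i)"
    using E assms by (intro mult_right_mono prod_nonneg) auto
  finally show ?thesis
    unfolding gbinomial_eq_prod times_divide_eq_right by (rule divide_right_mono) simp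
qed

section \<open>Stirling-type bounds and proportional splitting\<close>

lemma power_self_le_fact_exp: "real n ^ n \<le> fact n * exp (real n)"
proof (induction n)
  case (Suc n)
  show ?case
  proof (cases "n = 0")
    case False
    have "(1 + 1 / real n) ^ n \<le> exp (1 / real n) ^ n"
      by (intro power_mono exp_ge_add_one_self) auto
    also have "\<dots> = exp 1" using False by (simp flip: exp_of_nat_mult)
    finally have "(1 + 1 / real n) ^ n * real n ^ n \<le> exp 1 * (fact n * exp (real n))"
      using Suc.IH by (intro mult_mono) auto
    moreover have "(1 + 1 / real n) ^ n * real n ^ n = real (Suc n) ^ n"
      using False by (simp add: power_mult_distrib[symmetric] field_simps)
    ultimately have "real (Suc n) * real (Suc n) ^ n \<le> real (Suc n) * (exp 1 * (fact n * exp (real n)))"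
      by (intro mult_left_mono) auto
    then show ?thesis by (simp add: exp_add algebra_simps)
  qed simp
qed simp

text \<open>The reverse of \<open>power_self_le_fact_exp\<close> up to a factor linear in
  \<open>n\<close>. The induction step rests on \<open>(n / (n + 1)) ^ (n + 1) <= 1 / e\<close>, as
  the other one does on \<open>(1 + 1 / n) ^ n <= e\<close>.\<close>

lemma fact_exp_le: "0 < n \<Longrightarrow> fact n * exp (real n) \<le> exp 1 * real n * real n ^ n"
proof (induction n rule: nat_induct_non_zero)
  case (Suc n)
  have "1 - 1 / real (Suc n) \<le> exp (- (1 / real (Suc n)))"
    using exp_ge_add_one_self[of "- (1 / real (Suc n))"] by simp
  then have "(real n / real (Suc n)) ^ Suc n \<le> exp (- (1 / real (Suc n))) ^ Suc n"
    by (intro power_mono) (auto simp: field_simps)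
  also have "\<dots> = exp (- 1)" by (simp del: of_nat_Suc power_Suc flip: exp_of_nat_mult)
  finally have "real n ^ Suc n \<le> exp (- 1) * real (Suc n) ^ Suc n"
    by (simp add: power_divide pos_divide_le_eq)
  then have "exp 1 * real n ^ Suc n \<le> exp 1 * (exp (- 1) * real (Suc n) ^ Suc n)"
    by (intro mult_left_mono) auto
  then have key: "exp 1 * real n ^ Suc n \<le> real (Suc n) ^ Suc n" by (simp flip: exp_add mult.assoc)
  have "fact (Suc n) * exp (real (Suc n)) = real (Suc n) * exp 1 * (fact n * exp (real n))"
    by (simp add: exp_add algebra_simps)
  also have "\<dots> \<le> real (Suc n) * exp 1 * (exp 1 * real n * real n ^ n)"
    using Suc.IH by (intro mult_left_mono) auto
  also have "\<dots> = exp 1 * real (Suc n) * (exp 1 * real n ^ Suc n)" by simp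
  also have "\<dots> \<le> exp 1 * real (Suc n) * real (Suc n) ^ Suc n"
    using key by (intro mult_left_mono) auto
  finally show ?case .
qed simp

text \<open>The sequences \<open>\<lceil>i(s + s') / s\<rceil>\<close> and \<open>\<lfloor>j(s + s') / s'\<rfloor> + 1\<close> partition \<open>{..<s + s'}\<close>,
  in the manner of Beatty sequences.\<close>

lemma prod_le_proportional_split:
  fixes M :: real
  assumes s: "0 < s" "0 < s'" and M: "real (s + s') \<le> M"
  shows "(\<Prod>k<s + s'. M - real k) \<le>
    (\<Prod>i<s. M - real i * real (s + s') / real s) * (\<Prod>j<s'. M - real j * real (s + s') / real s')"
proof -
  define T where "T = s + s'"
  \<comment> \<open>Adding \<open>s - 1\<close> before the division rounds up. The
    \<open>+ 1\<close> in \<open>g\<close> keeps the two sequences apart; for instance,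
    \<open>f 0 = 0\<close> and \<open>g 0 = 1\<close>.\<close>
  define f where "f i = (i * T + s - 1) div s" for i
  define g where "g j = j * T div s' + 1" for j
  have f1: "i * T \<le> f i * s" and f2: "f i * s < i * T + s" for i
  proof -
    have e: "f i * s + (i * T + s - 1) mod s = i * T + s - 1"
      unfolding f_def by (rule div_mult_mod_eq)
    moreover have "(i * T + s - 1) mod s < s" using s by simp
    ultimately show "i * T \<le> f i * s" "f i * s < i * T + s" using s by linarith+
  qed
  have g1: "j * T < g j * s'" and g2: "g j * s' \<le> j * T + s'" for j
  proof -
    have "j * T div s' * s' + j * T mod s' = j * T" by (rule div_mult_mod_eq)
    moreover have "j * T mod s' < s'" using s by simp
    moreover have "g j * s' = j * T div s' * s' + s'" by (simp add: g_def)
    ultimately show "j * T < g j * s'" "g j * s' \<le> j * T + s'" by linarith+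
  qed
  have sT: "s < T" "s' < T" using s by (auto simp: T_def)
  have next_le: "i * T + T \<le> i' * T" if "i < i'" for i i'
    using mult_le_mono1[of "Suc i" i' T] that by simp
  have monof: "f i < f i'" if "i < i'" for i i'
  proof -
    have "f i * s < f i' * s" using f2[of i] f1[of i'] next_le[OF that] sT by linarith
    then show ?thesis by simp
  qed
  have monog: "g i < g i'" if "i < i'" for i i'
  proof -
    have "g i * s' < g i' * s'" using g2[of i] g1[of i'] next_le[OF that] sT by linarith
    then show ?thesis by simp
  qed
  have injf: "inj_on f {..<s}" using monof by (intro inj_onI) (metis less_irrefl linorder_neqE_nat)
  have injg: "inj_on g {..<s'}" using monog by (intro inj_onI) (metis less_irrefl linorder_neqE_nat)
  have disj: "f i \<noteq> g j" for i j
  proof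
    \<comment> \<open>For a common value \<open>v\<close>, adding the bounds for
      \<open>v * s\<close> and \<open>v * s'\<close> puts \<open>v * T\<close> strictly between
      \<open>(i + j) * T\<close> and \<open>(i + j + 1) * T\<close>.\<close>
    assume eq: "f i = g j"
    have fT: "f i * T = f i * s + g j * s'" unfolding T_def eq by (simp add: algebra_simps)
    have "(i + j) * T < f i * T" using f1[of i] g1[of j] by (simp add: fT add_mult_distrib)
    moreover have "f i * T < (i + j + 1) * T"
      using f2[of i] g2[of j] by (simp add: fT add_mult_distrib) (simp add: T_def)
    ultimately have "i + j < f i" "f i < i + j + 1" by (simp_all only: mult_less_cancel2)
    then show False by simp
  qed
  have rf: "f i < T" if "i < s" for i
  proof -
    have "f i * s < s * T" using f2[of i] next_le[OF that] sT by linarith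
    then show ?thesis by (simp add: mult.commute[of s])
  qed
  have rg: "g j < T" if "j < s'" for j
  proof -
    have "g j * s' < s' * T" using g2[of j] next_le[OF that] sT by linarith
    then show ?thesis by (simp add: mult.commute[of s'])
  qed
  have dj: "f ` {..<s} \<inter> g ` {..<s'} = {}" using disj by auto
  have "f ` {..<s} \<union> g ` {..<s'} = {..<T}"
  proof (rule card_subset_eq)
    show "f ` {..<s} \<union> g ` {..<s'} \<subseteq> {..<T}" using rf rg by auto
    show "card (f ` {..<s} \<union> g ` {..<s'}) = card {..<T}"
      using dj by (subst card_Un_disjoint) (auto simp: card_image injf injg T_def)
  qed simp
  then have "(\<Prod>k<T. M - real k) = (\<Prod>k\<in>f ` {..<s} \<union> g ` {..<s'}. M - real k)" by simp
  also have "\<dots> = (\<Prod>i<s. M - real (f i)) * (\<Prod>j<s'. M - real (g j))"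
    using dj by (subst prod.union_disjoint) (auto simp: prod.reindex injf injg)
  also have "\<dots> \<le> (\<Prod>i<s. M - real i * real T / real s) * (\<Prod>j<s'. M - real j * real T / real s')"
  proof (intro mult_mono prod_mono conjI prod_nonneg ballI)
    have le1: "real i * real T / real s \<le> real (f i)" for i
      using f1[of i] s by (simp add: pos_divide_le_eq flip: of_nat_mult)
    have le2: "real j * real T / real s' \<le> real (g j)" for j
      using g1[of j] s by (simp add: pos_divide_le_eq flip: of_nat_mult)
    show *: "0 \<le> M - real (f i)" if "i \<in> {..<s}" for i
      using rf[of i] that M by (simp add: T_def)
    show **: "0 \<le> M - real (g i)" if "i \<in> {..<s'}" for i
      using rg[of i] that M by (simp add: T_def)
    show "0 \<le> M - real (g i)" if "i \<in> {..<s'}" for i using **[OF that] .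
    show "M - real (f i) \<le> M - real i * real T / real s" for i using le1[of i] by simp
    show "M - real (g i) \<le> M - real i * real T / real s'" for i using le2[of i] by simp
    show "0 \<le> M - real i * real T / real s" if "i \<in> {..<s}" for i
      using le1[of i] *[OF that] by simp
  qed
  finally show ?thesis by (simp add: T_def)
qed

text \<open>Taking \<open>u / T\<close> out of each factor leaves the products of
  \<open>prod_le_proportional_split\<close>. It remains to compare powers with factorials; the
  exponentials in the Stirling-type bounds cancel because \<open>T = s + s'\<close>.\<close>

lemma gbinomial_le_proportional_split:
  fixes M :: real
  assumes s: "0 < s" "0 < s'" and M: "real (s + s') \<le> M"
  shows "(M gchoose (s + s')) \<le> exp 2 * real s * real s' *
    ((M * real s / real (s + s') gchoose s) * (M * real s' / real (s + s') gchoose s'))"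
proof -
  define T where "T = s + s'"
  define P where "P = (\<Prod>i<s. M - real i * real T / real s)"
  define P' where "P' = (\<Prod>j<s'. M - real j * real T / real s')"
  have T: "0 < T" using s by (simp add: T_def)
  have split: "(M * real u / real T gchoose u) = real u ^ u / real T ^ u * (\<Prod>i<u. M - real i * real T / real u) / fact u"
    if "0 < u" for u
  proof -
    have "(\<Prod>i<u. M * real u / real T - real i) = (\<Prod>i<u. (real u / real T) * (M - real i * real T / real u))"
      using that T by (intro prod.cong) (auto simp: field_simps)
    also have "\<dots> = (real u / real T) ^ u * (\<Prod>i<u. M - real i * real T / real u)"
      by (simp only: prod.distrib prod_constant card_lessThan)
    finally show ?thesis by (simp only: gbinomial_eq_prod power_divide)
  qed
  define Q where "Q = (\<Prod>k<T. M - real k)"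
  have Q: "0 \<le> Q" "Q \<le> P * P'"
    using prod_le_proportional_split[OF assms] M
    by (auto simp: Q_def P_def P'_def T_def intro!: prod_nonneg)
  have "fact s * exp (real s) * (fact s' * exp (real s')) * real T ^ T
      \<le> (exp 1 * real s * real s ^ s) * (exp 1 * real s' * real s' ^ s') * (fact T * exp (real T))"
    by (rule mult_mono[OF mult_mono[OF fact_exp_le[OF s(1)] fact_exp_le[OF s(2)]]
          power_self_le_fact_exp[of T]]) auto
  also have "\<dots> = exp 2 * real s * real s' * (real s ^ s * real s' ^ s') * fact T * exp (real T)"
    by (simp add: exp_double[of 1, simplified] power2_eq_square)
  finally have "(fact s * fact s' * real T ^ T) * exp (real T)
      \<le> (exp 2 * real s * real s' * (real s ^ s * real s' ^ s') * fact T) * exp (real T)"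
    by (simp add: T_def exp_add algebra_simps)
  then have key: "fact s * fact s' * real T ^ T \<le> exp 2 * real s * real s' * (real s ^ s * real s' ^ s') * fact T"
    by (simp only: mult_le_cancel_right) simp
  have "Q / fact T = Q * (fact s * fact s' * real T ^ T) / (fact s * fact s' * real T ^ T * fact T)"
    using T by simp
  also have "\<dots> \<le> (P * P') * (exp 2 * real s * real s' * (real s ^ s * real s' ^ s') * fact T) / (fact s * fact s' * real T ^ T * fact T)"
    using Q by (intro divide_right_mono mult_mono[OF Q(2) key]) auto
  also have "\<dots> = exp 2 * real s * real s' * ((real s ^ s / real T ^ s * P / fact s) * (real s' ^ s' / real T ^ s' * P' / fact s'))"
    using T by (simp add: T_def power_add field_simps)
  also have "\<dots> = exp 2 * real s * real s' * ((M * real s / real T gchoose s) * (M * real s' / real T gchoose s'))"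
    using s by (simp add: split P_def P'_def)
  finally show ?thesis by (simp add: Q_def gbinomial_eq_prod T_def)
qed

lemma choose_le_real_choose_split:
  fixes M c :: real
  assumes s: "0 < s" "0 < s'" and M: "real (s + s') \<le> M" and c: "0 \<le> c"
    and N: "real N \<le> (1 + c) * M"
  shows "real (N choose (s + s')) \<le> exp (4 * sqrt c * real (s + s')) * (exp 2 * real s * real s') *
    (real_choose (M * real s / real (s + s')) s * real_choose (M * real s' / real (s + s')) s')"
proof -
  have M0: "0 \<le> c * M" using c M by (intro mult_nonneg_nonneg) auto
  have "real (N choose (s + s')) \<le> ((1 + c) * M gchoose (s + s'))"
  proof (cases "s + s' \<le> N")
    case True
    then show ?thesis using N by (simp add: binomial_gbinomial gbinomial_real_mono)
  next
    case False
    then show ?thesis using M M0 by (simp add: binomial_eq_0 gbinomial_real_nonneg algebra_simps)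
  qed
  also have "\<dots> \<le> exp (4 * sqrt c * real (s + s')) * (M gchoose (s + s'))"
    by (rule gbinomial_scale_le[OF M c])
  also have "\<dots> \<le> exp (4 * sqrt c * real (s + s')) * (exp 2 * real s * real s' *
    ((M * real s / real (s + s') gchoose s) * (M * real s' / real (s + s') gchoose s')))"
    by (intro mult_left_mono gbinomial_le_proportional_split s M) auto
  also have "(M * real s / real (s + s') gchoose s) = real_choose (M * real s / real (s + s')) s"
    using s M mult_right_mono[OF M, of "real s"] by (simp add: real_choose_def pos_le_divide_eq mult.commute)
  also have "(M * real s' / real (s + s') gchoose s') = real_choose (M * real s' / real (s + s')) s'"
    using s M mult_right_mono[OF M, of "real s'"] by (simp add: real_choose_def pos_le_divide_eq mult.commute)
  finally show ?thesis by (simp add: mult.assoc)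
qed

section \<open>Asymptotics\<close>

lemma card_le_max_subgroup_size:
  assumes "subgroup H G" "finite H" "real (card H) \<le> x"
  shows "card H \<le> max_subgroup_size G x"
  unfolding max_subgroup_size_def
proof (rule Max_ge)
  show "finite {card H |H. subgroup H G \<and> finite H \<and> real (card H) \<le> x}"
    by (rule finite_subset[of _ "{..nat \<lfloor>x\<rfloor>}"]) (auto simp: le_nat_floor)
qed (use assms in blast)

lemma (in comm_group) card_small_pairs_le_real_choose:
  fixes \<epsilon> :: real
  assumes Y: "finite Y" "Y \<subseteq> carrier G"
    and s: "0 < s" "0 < s'" "s + s' \<le> m"
    and \<epsilon>: "0 < \<epsilon>" "\<epsilon> \<le> 1" "1 \<le> \<epsilon> * m"
    and d: "0 < d" "m \<le> d * d"
    and k: "64 \<le> \<epsilon>\<^sup>2 * k" "real (k * d) \<le> \<epsilon> ^ 3 * m / 64" "k * d \<le> s" "k * d \<le> s'"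
    and r: "320 < r * \<epsilon> ^ 3"
  defines "\<beta> \<equiv> real (max_subgroup_size G ((1 + \<epsilon>) * m))"
  shows "real (card (small_pairs G s s' m Y Y {})) \<le> real ((2 * (card Y + 1) ^ (2 * k * d)) ^ (r + 2)) *
    (exp (4 * sqrt (2 * \<epsilon>) * real (s + s')) * (exp 2 * real s * real s') *
    (real_choose ((m + \<beta>) * real s / real (s + s')) s * real_choose ((m + \<beta>) * real s' / real (s + s')) s'))"
proof -
  let ?N = "nat \<lfloor>(1 + 2 * \<epsilon>) * m + \<beta>\<rfloor>"
  have \<beta>0: "0 \<le> \<beta>" by (simp add: \<beta>_def)
  have sub: "real (card H) \<le> \<beta>" if "subgroup H G" "finite H" "real (card H) \<le> (1 + \<epsilon>) * m" for H
    unfolding \<beta>_def using card_le_max_subgroup_size[OF that] by simp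
  have "card (small_pairs G s s' m Y Y {})
      \<le> (2 * (card Y + 1) ^ (2 * k * d)) ^ (r + 2) * (?N choose (s + s'))"
    by (rule card_small_pairs_le_choose[OF Y \<epsilon> d k sub \<beta>0 r])
  then have "real (card (small_pairs G s s' m Y Y {}))
      \<le> real ((2 * (card Y + 1) ^ (2 * k * d)) ^ (r + 2)) * real (?N choose (s + s'))"
    by (metis of_nat_le_iff of_nat_mult)
  also have "real (?N choose (s + s')) \<le> exp (4 * sqrt (2 * \<epsilon>) * real (s + s')) * (exp 2 * real s * real s') *
    (real_choose ((m + \<beta>) * real s / real (s + s')) s * real_choose ((m + \<beta>) * real s' / real (s + s')) s')"
  proof (rule choose_le_real_choose_split[OF s(1,2)])
    show "real (s + s') \<le> m + \<beta>" using s(3) \<beta>0 by linarith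
    have "0 \<le> \<epsilon> * \<beta>" "0 \<le> \<epsilon> * m" using \<epsilon> \<beta>0 by auto
    then have "real ?N \<le> (1 + 2 * \<epsilon>) * m + \<beta>"
      using \<beta>0 by (intro of_nat_floor) (auto simp: algebra_simps)
    \<comment> \<open>The excess over \<open>m + \<beta>\<close> is treated as a scaling of the
      upper entry, with \<open>c = 2 * \<epsilon>\<close>.\<close>
    also have "\<dots> \<le> (1 + 2 * \<epsilon>) * (m + \<beta>)"
      using \<open>0 \<le> \<epsilon> * \<beta>\<close> by (simp add: algebra_simps)
    finally show "real ?N \<le> (1 + 2 * \<epsilon>) * (m + \<beta>)" .
  qed (use \<epsilon> in auto)
  finally show ?thesis by (simp add: mult_left_mono)
qed

text \<open>Ensures that the right-hand side of the final bound is nonnegative, and that for a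
  single \<open>n\<close> a large exponent alone makes the bound true.\<close>

lemma real_choose_ge_one:
  fixes M :: real
  assumes "0 < u" "real u \<le> real T" "real T \<le> M"
  shows "1 \<le> real_choose (M * real u / real T) u"
proof -
  have "real u \<le> M * real u / real T"
    using assms mult_right_mono[OF assms(3), of "real u"] by (simp add: pos_le_divide_eq mult.commute)
  then show ?thesis by (simp add: real_choose_def gbinomial_real_ge_one)
qed

text \<open>Accuracy \<open>1 / (j + 1)\<close> is available from a threshold \<open>N j\<close> on;
  at \<open>n\<close>, the best index available up to \<open>n\<close> is used.\<close>

lemma eventually_diagonal:
  fixes P :: "nat \<Rightarrow> real \<Rightarrow> real \<Rightarrow> bool"
  assumes ev: "\<And>\<delta>. 0 < \<delta> \<Longrightarrow> \<exists>\<eta>. 0 \<le> \<eta> \<and> \<eta> \<le> \<delta> \<and> (\<forall>\<^sub>F n in sequentially. P n \<delta> \<eta>)"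
    and triv: "\<And>n. \<exists>\<epsilon> \<eta>. P n \<epsilon> \<eta>"
  shows "\<exists>\<epsilon> \<eta>. \<epsilon> \<longlonglongrightarrow> 0 \<and> \<eta> \<longlonglongrightarrow> 0 \<and> (\<forall>n. P n (\<epsilon> n) (\<eta> n))"
proof -
  have "\<exists>h N. 0 \<le> h \<and> h \<le> inverse (real (Suc j)) \<and> (\<forall>n\<ge>N. P n (inverse (real (Suc j))) h)" for j
    using ev[of "inverse (real (Suc j))"] by (auto simp: eventually_sequentially)
  then obtain h N where h: "\<And>j. 0 \<le> h j" "\<And>j. h j \<le> inverse (real (Suc j))"
    and N: "\<And>j n. N j \<le> n \<Longrightarrow> P n (inverse (real (Suc j))) (h j)"
    by metis
  obtain e e' where e: "\<And>n. P n (e n) (e' n)" using triv by metis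
  define g where "g n = Max {j. j \<le> n \<and> N j \<le> n}" for n
  define \<epsilon> where "\<epsilon> n = (if N 0 \<le> n then inverse (real (Suc (g n))) else e n)" for n
  define \<eta> where "\<eta> n = (if N 0 \<le> n then h (g n) else e' n)" for n
  have g_mem: "N (g n) \<le> n" if "N 0 \<le> n" for n
  proof -
    have "g n \<in> {j. j \<le> n \<and> N j \<le> n}"
      unfolding g_def using that by (intro Max_in) auto
    then show ?thesis by simp
  qed
  have "\<forall>\<^sub>F n in sequentially. J \<le> g n" for J
    using eventually_ge_at_top[of "max J (N J)"]
    by eventually_elim (auto simp: g_def intro!: Max_ge)
  then have g: "filterlim g at_top sequentially" by (simp add: filterlim_at_top)
  have lim: "(\<lambda>n. inverse (real (Suc (g n)))) \<longlonglongrightarrow> 0"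
    by (rule filterlim_compose[OF LIMSEQ_inverse_real_of_nat g])
  have ev0: "\<forall>\<^sub>F n in sequentially. N 0 \<le> n" by (rule eventually_ge_at_top)
  have "\<epsilon> \<longlonglongrightarrow> 0"
    by (rule Lim_transform_eventually[OF lim]) (use ev0 in eventually_elim, simp add: \<epsilon>_def)
  moreover have "\<eta> \<longlonglongrightarrow> 0"
  proof (rule tendsto_sandwich[OF _ _ tendsto_const lim])
    show "\<forall>\<^sub>F n in sequentially. 0 \<le> \<eta> n"
      using ev0 by eventually_elim (simp add: \<eta>_def h)
    show "\<forall>\<^sub>F n in sequentially. \<eta> n \<le> inverse (real (Suc (g n)))"
      using ev0 by eventually_elim (simp add: \<eta>_def h del: of_nat_Suc)
  qed
  moreover have "P n (\<epsilon> n) (\<eta> n)" for n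
    using N[OF g_mem, of n] e[of n] by (simp add: \<epsilon>_def \<eta>_def del: of_nat_Suc)
  ultimately show ?thesis by blast
qed

text \<open>\<open>sqrt m * log 2 n\<close> is the quantity that the growth condition on
  \<open>m\<close> makes \<open>o(s)\<close>. In the constant 9, a 1 pays for the factor 2, and 8
  comes from \<open>n + 1 <= n^2\<close> and \<open>d <= 2 * sqrt m\<close>.\<close>

lemma fingerprint_count_le:
  fixes m n k d r :: nat
  assumes n: "2 \<le> n" and m: "1 \<le> m" and d: "real d \<le> 2 * sqrt m" and k: "1 \<le> k"
  shows "real ((2 * (n + 1) ^ (2 * k * d)) ^ (r + 2)) \<le> 2 powr (9 * real k * real (r + 2) * (sqrt (real m) * log 2 (real n)))"
proof -
  have l1: "1 \<le> log 2 (real n)" using n by (simp add: le_log_iff)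
  have sm: "1 \<le> sqrt (real m)" using m by simp
  have "2 * real n \<le> real n * real n" using n by (intro mult_right_mono) auto
  moreover have "2 \<le> real n" using n by simp
  ultimately have "real (n + 1) \<le> real n * real n" by linarith
  also have "real n = 2 powr log 2 (real n)" using n by simp
  also have "2 powr log 2 (real n) * 2 powr log 2 (real n) = 2 powr (2 * log 2 (real n))"
    by (simp only: mult_2 powr_add)
  finally have n1: "real (n + 1) \<le> 2 powr (2 * log 2 (real n))" .
  have "real (2 * (n + 1) ^ (2 * k * d)) = 2 * real (n + 1) ^ (2 * k * d)" by simp
  also have "\<dots> \<le> 2 * (2 powr (2 * log 2 (real n))) ^ (2 * k * d)"
    by (intro mult_left_mono power_mono n1) auto
  also have "\<dots> = 2 powr 1 * 2 powr (4 * real k * real d * log 2 (real n))"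
    by (simp add: powr_realpow[symmetric] powr_powr algebra_simps)
  also have "\<dots> = 2 powr (1 + 4 * real k * real d * log 2 (real n))" by (simp add: powr_add)
  also have "\<dots> \<le> 2 powr (9 * real k * (sqrt (real m) * log 2 (real n)))"
  proof (rule powr_mono)
    have "1 * 1 \<le> sqrt m * log 2 (real n)" using l1 sm by (intro mult_mono) auto
    then have "1 * 1 \<le> real k * (sqrt m * log 2 (real n))" using k by (intro mult_mono) auto
    moreover have "real d * (4 * k * log 2 (real n)) \<le> (2 * sqrt m) * (4 * k * log 2 (real n))"
      using d l1 by (intro mult_right_mono) auto
    ultimately show "1 + 4 * real k * real d * log 2 (real n) \<le> 9 * real k * (sqrt (real m) * log 2 (real n))"
      by (simp add: algebra_simps)
  qed simp
  finally have "real (2 * (n + 1) ^ (2 * k * d)) ^ (r + 2) \<le> (2 powr (9 * real k * (sqrt (real m) * log 2 (real n)))) ^ (r + 2)"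
    by (intro power_mono) auto
  also have "\<dots> = 2 powr (9 * real k * real (r + 2) * (sqrt (real m) * log 2 (real n)))"
    by (simp add: powr_realpow[symmetric] powr_powr algebra_simps del: power_Suc)
  finally show ?thesis by simp
qed

text \<open>With \<open>\<epsilon>\<close>, \<open>k\<close> and \<open>r\<close> depending only on
  \<open>\<delta>\<close> and \<open>C\<close>, the exponent \<open>\<delta> * s\<close> is shared
  out: a quarter for the fingerprints, a half for scaling the upper entry, a quarter for the
  polynomial factor.\<close>

lemma eventually_small_pairs_bound:
  fixes G :: "nat \<Rightarrow> ('a, 'b) monoid_scheme"
    and Y :: "nat \<Rightarrow> 'a set"
    and m s s' :: "nat \<Rightarrow> nat"
    and C \<delta> :: real
  assumes G: "\<And>n. comm_group (G n)"
    and Y: "\<And>n. Y n \<subseteq> carrier (G n)" "\<And>n. finite (Y n)" "\<And>n. card (Y n) = n"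
    and pos: "\<And>n. s n > 0" "\<And>n. s' n > 0"
    and C: "C \<ge> 1" "\<And>n. real (s n) / C \<le> real (s' n)" "\<And>n. real (s' n) \<le> C * real (s n)"
    and sm: "\<And>n. s n + s' n \<le> m n"
    and small: "(\<lambda>n. real (m n)) \<in> o(\<lambda>n. (real (s n))\<^sup>2 / (log 2 (real n))\<^sup>2)"
    and \<delta>: "0 < \<delta>"
  shows "\<exists>\<eta>\<ge>0. \<eta> \<le> \<delta> \<and> (\<forall>\<^sub>F n in sequentially.
      real (card (small_pairs (G n) (s n) (s' n) (m n) (Y n) (Y n) {}))
      \<le> 2 powr (\<delta> * real (s n))
        * real_choose ((real (m n) + real (max_subgroup_size (G n) ((1 + \<eta>) * real (m n)))) * real (s n) / real (s n + s' n)) (s n)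
        * real_choose ((real (m n) + real (max_subgroup_size (G n) ((1 + \<eta>) * real (m n)))) * real (s' n) / real (s n + s' n)) (s' n))"
proof -
  \<comment> \<open>Chosen so that \<open>4 * w * (1 + C) = \<delta> / 2 * ln 2\<close>; since
    \<open>sqrt (2 * \<epsilon>) <= w\<close>, the scaling factor stays below
    \<open>2 powr (\<delta> / 2 * s)\<close>.\<close>
  define w where "w = \<delta> * ln 2 / (8 * (1 + C))"
  define \<epsilon> where "\<epsilon> = min (min 1 \<delta>) (w\<^sup>2 / 2)"
  have w: "0 < w" using \<delta> C by (simp add: w_def)
  have \<epsilon>: "0 < \<epsilon>" "\<epsilon> \<le> 1" "\<epsilon> \<le> \<delta>" "2 * \<epsilon> \<le> w\<^sup>2"
    using \<delta> w by (auto simp: \<epsilon>_def min_def)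
  have sq: "sqrt (2 * \<epsilon>) \<le> w" using \<epsilon>(4) w real_le_lsqrt by (metis less_imp_le)
  define k where "k = nat \<lceil>64 / \<epsilon>\<^sup>2\<rceil>"
  define r where "r = Suc (nat \<lceil>320 / \<epsilon> ^ 3\<rceil>)"
  have "64 / \<epsilon>\<^sup>2 \<le> real k" unfolding k_def by (rule real_nat_ceiling_ge)
  then have k: "64 \<le> \<epsilon>\<^sup>2 * k" using \<epsilon>(1) by (simp add: pos_divide_le_eq mult.commute)
  have "320 / \<epsilon> ^ 3 \<le> real (nat \<lceil>320 / \<epsilon> ^ 3\<rceil>)" by (rule real_nat_ceiling_ge)
  then have "320 / \<epsilon> ^ 3 < real r" by (simp add: r_def)
  then have r: "320 < r * \<epsilon> ^ 3" using \<epsilon>(1) by (simp add: pos_divide_less_eq)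
  have k1: "1 \<le> k" using k by (cases "k = 0") auto
  define L where "L n = sqrt (real (m n)) * log 2 (real n)" for n
  have m1: "1 \<le> m n" for n using sm[of n] pos(1)[of n] by linarith
  have L: "\<forall>\<^sub>F n in sequentially. L n \<le> \<kappa> * real (s n)" if \<kappa>: "0 < \<kappa>" for \<kappa>
  proof -
    have "\<forall>\<^sub>F n in sequentially. norm (real (m n)) \<le> \<kappa>\<^sup>2 * norm ((real (s n))\<^sup>2 / (log 2 (real n))\<^sup>2)"
      using \<kappa> by (intro landau_o.smallD[OF small]) simp
    then show ?thesis using eventually_ge_at_top[of 2]
    proof eventually_elim
      case (elim n)
      have l: "0 < log 2 (real n)" using elim(2) by simp
      have "real (m n) \<le> (\<kappa> * real (s n) / log 2 (real n))\<^sup>2"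
        using elim(1) by (simp add: power_divide power_mult_distrib)
      then have "sqrt (real (m n)) \<le> \<kappa> * real (s n) / log 2 (real n)"
        using \<kappa> l by (intro real_le_lsqrt) auto
      then show ?case using l by (simp add: L_def pos_le_divide_eq)
    qed
  qed
  have L_ge: "log 2 (real n) \<le> L n" "sqrt (real (m n)) \<le> L n" if "2 \<le> n" for n
  proof -
    have l1: "1 \<le> log 2 (real n)" using that by (simp add: le_log_iff)
    have m1': "1 \<le> sqrt (real (m n))" using m1[of n] by simp
    show "log 2 (real n) \<le> L n" using mult_right_mono[OF m1', of "log 2 (real n)"] l1 by (simp add: L_def)
    show "sqrt (real (m n)) \<le> L n" using mult_left_mono[OF l1, of "sqrt (real (m n))"] by (simp add: L_def)
  qed
  \<comment> \<open>\<open>s\<close> tends to infinity because eventually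
    \<open>log 2 n <= L n <= s n\<close>.\<close>
  have "filterlim (\<lambda>n. log 2 (real n)) at_top sequentially" by real_asymp
  moreover have "\<forall>\<^sub>F n in sequentially. log 2 (real n) \<le> real (s n)"
    using L[of 1, simplified] eventually_ge_at_top[of 2] by eventually_elim (use L_ge in force)
  ultimately have s_lim: "filterlim (\<lambda>n. real (s n)) at_top sequentially"
    by (rule filterlim_at_top_mono)
  have "\<forall>\<^sub>F x in at_top. exp 2 * C * x\<^sup>2 \<le> 2 powr (\<delta> / 4 * x)" using \<delta> C by real_asymp
  then have poly: "\<forall>\<^sub>F n in sequentially. exp 2 * C * (real (s n))\<^sup>2 \<le> 2 powr (\<delta> / 4 * real (s n))"
    by (rule eventually_compose_filterlim[OF _ s_lim])
  have s_ge: "\<forall>\<^sub>F n in sequentially. B \<le> real (s n)" for B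
    using s_lim by (simp add: filterlim_at_top)
  \<comment> \<open>As bounds for \<open>L n / s n\<close>, the first constant gives
    \<open>k * d <= s / C\<close>, hence \<open>k * d <= s'\<close>, and the second bounds the
    fingerprint factor by \<open>2 powr (\<delta> / 4 * s)\<close>.\<close>
  have \<kappa>: "0 < 1 / (2 * real k * C)" "0 < \<delta> / (36 * real k * real (r + 2))"
    using k1 C \<delta> by simp_all
  \<comment> \<open>The two lower bounds on \<open>s <= m\<close> yield
    \<open>1 <= \<epsilon> * m\<close> and, through \<open>k * d <= 2 * k * sqrt m\<close>, the
    condition \<open>k * d <= \<epsilon> ^ 3 * m / 64\<close>.\<close>
  have "\<forall>\<^sub>F n in sequentially.
      real (card (small_pairs (G n) (s n) (s' n) (m n) (Y n) (Y n) {}))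
      \<le> 2 powr (\<delta> * real (s n))
        * real_choose ((real (m n) + real (max_subgroup_size (G n) ((1 + \<epsilon>) * real (m n)))) * real (s n) / real (s n + s' n)) (s n)
        * real_choose ((real (m n) + real (max_subgroup_size (G n) ((1 + \<epsilon>) * real (m n)))) * real (s' n) / real (s n + s' n)) (s' n)"
    using eventually_ge_at_top[of 2] poly s_ge[of "1 / \<epsilon>"] s_ge[of "(128 * real k / \<epsilon> ^ 3)\<^sup>2"]
      L[OF \<kappa>(1)] L[OF \<kappa>(2)]
  proof eventually_elim
    case (elim n)
    interpret comm_group "G n" by (rule G)
    define d where "d = nat \<lceil>sqrt (real (m n))\<rceil>"
    have rm: "1 \<le> sqrt (real (m n))" using m1[of n] by simp
    have d_ge: "sqrt (real (m n)) \<le> real d" unfolding d_def by (rule real_nat_ceiling_ge)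
    have d_le: "real d \<le> 2 * sqrt (real (m n))" using rm unfolding d_def by linarith
    have d0: "0 < d" using d_ge rm by (cases "d = 0") auto
    have "real (m n) \<le> real d * real d"
      using mult_mono[OF d_ge d_ge] by simp
    then have d2: "m n \<le> d * d" by (simp flip: of_nat_mult)
    have ms: "real (s n) \<le> real (m n)" using sm[of n] by linarith
    have em: "1 \<le> \<epsilon> * m n" using elim(3) ms \<epsilon>(1) by (simp add: pos_divide_le_eq mult.commute order_trans)
    have kd_le: "real (k * d) \<le> 2 * real k * sqrt (real (m n))"
      using mult_left_mono[OF d_le, of "real k"] by simp
    have "128 * real k / \<epsilon> ^ 3 \<le> sqrt (real (m n))"
      using elim(4) ms \<epsilon>(1) by (intro real_le_rsqrt) auto
    then have "128 * real k \<le> \<epsilon> ^ 3 * sqrt (real (m n))" using \<epsilon>(1) by (simp add: pos_divide_le_eq mult.commute)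
    from mult_right_mono[OF this, of "sqrt (real (m n))"]
    have "128 * real k * sqrt (real (m n)) \<le> \<epsilon> ^ 3 * m n" by (simp add: mult.assoc)
    then have kd1: "real (k * d) \<le> \<epsilon> ^ 3 * m n / 64" using kd_le by linarith
    have "2 * real k * sqrt (real (m n)) \<le> 2 * real k * L n" using L_ge(2)[OF elim(1)] by (intro mult_left_mono) auto
    also have "\<dots> \<le> 2 * real k * (1 / (2 * real k * C) * real (s n))" using elim(5) k1 C by (intro mult_left_mono) auto
    also have "\<dots> = real (s n) / C" using k1 C by simp
    finally have kds: "real (k * d) \<le> real (s n) / C" using kd_le by linarith
    also have "\<dots> \<le> real (s n)" using C(1) by (simp add: divide_le_eq_1 pos_divide_le_eq mult_left_mono[of 1 C "real (s n)", simplified])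
    finally have kd2: "k * d \<le> s n" by (simp only: of_nat_le_iff)
    have kd3: "k * d \<le> s' n" using order_trans[OF kds C(2)] by (simp only: of_nat_le_iff)
    let ?\<beta> = "real (max_subgroup_size (G n) ((1 + \<epsilon>) * real (m n)))"
    let ?R = "real_choose ((real (m n) + ?\<beta>) * real (s n) / real (s n + s' n)) (s n)
        * real_choose ((real (m n) + ?\<beta>) * real (s' n) / real (s n + s' n)) (s' n)"
    have R0: "0 \<le> ?R"
    proof (intro mult_nonneg_nonneg)
      have T: "real (s n + s' n) \<le> real (m n) + ?\<beta>" using sm[of n] by linarith
      show "0 \<le> real_choose ((real (m n) + ?\<beta>) * real (s n) / real (s n + s' n)) (s n)"
        using real_choose_ge_one[OF pos(1)[of n] _ T] by simp
      show "0 \<le> real_choose ((real (m n) + ?\<beta>) * real (s' n) / real (s n + s' n)) (s' n)"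
        using real_choose_ge_one[OF pos(2)[of n] _ T] by simp
    qed
    have F: "real ((2 * (n + 1) ^ (2 * k * d)) ^ (r + 2)) \<le> 2 powr (\<delta> / 4 * real (s n))"
    proof -
      have "real ((2 * (n + 1) ^ (2 * k * d)) ^ (r + 2)) \<le> 2 powr (9 * real k * real (r + 2) * L n)"
        unfolding L_def by (rule fingerprint_count_le[OF elim(1) m1 d_le k1])
      also have "\<dots> \<le> 2 powr (9 * real k * real (r + 2) * (\<delta> / (36 * real k * real (r + 2)) * real (s n)))"
        using elim(6) by (intro powr_mono mult_left_mono) auto
      also have "9 * real k * real (r + 2) * (\<delta> / (36 * real k * real (r + 2)) * real (s n)) = \<delta> / 4 * real (s n)"
      proof -
        have "9 * a * b * (\<delta> / (36 * a * b) * x) = \<delta> / 4 * x" if "0 < a" "0 < b" for a b x :: real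
          using that by (simp add: field_simps)
        from this[of "real k" "real (r + 2)"] show ?thesis using k1 by simp
      qed
      finally show ?thesis .
    qed
    have E: "exp (4 * sqrt (2 * \<epsilon>) * real (s n + s' n)) \<le> 2 powr (\<delta> / 2 * real (s n))"
    proof -
      have "4 * sqrt (2 * \<epsilon>) * real (s n + s' n) \<le> 4 * w * ((1 + C) * real (s n))"
        using sq C(3)[of n] w \<epsilon>(1) by (intro mult_mono) (auto simp: algebra_simps)
      also have "\<dots> = \<delta> / 2 * real (s n) * ln 2" using C(1) by (simp add: w_def field_simps)
      finally show ?thesis by (simp add: powr_def)
    qed
    have S: "exp 2 * real (s n) * real (s' n) \<le> 2 powr (\<delta> / 4 * real (s n))"
    proof -
      have "exp 2 * real (s n) * real (s' n) \<le> exp 2 * real (s n) * (C * real (s n))"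
        using C(3)[of n] by (intro mult_left_mono) auto
      also have "\<dots> = exp 2 * C * (real (s n))\<^sup>2" by (simp add: power2_eq_square)
      finally show ?thesis using elim(2) by linarith
    qed
    have "real (card (small_pairs (G n) (s n) (s' n) (m n) (Y n) (Y n) {}))
      \<le> real ((2 * (n + 1) ^ (2 * k * d)) ^ (r + 2)) *
        (exp (4 * sqrt (2 * \<epsilon>) * real (s n + s' n)) * (exp 2 * real (s n) * real (s' n)) * ?R)"
      using card_small_pairs_le_real_choose[OF Y(2)[of n] Y(1) pos(1,2) sm \<epsilon>(1,2) em d0 d2 k kd1 kd2 kd3 r]
      unfolding Y(3) .
    also have "\<dots> \<le> 2 powr (\<delta> / 4 * real (s n)) *
        (2 powr (\<delta> / 2 * real (s n)) * 2 powr (\<delta> / 4 * real (s n)) * ?R)"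
      by (rule mult_mono[OF F mult_right_mono[OF mult_mono[OF E S] R0]]) (use R0 in auto)
    also have "\<dots> = 2 powr (\<delta> / 4 * real (s n) + \<delta> / 2 * real (s n) + \<delta> / 4 * real (s n)) * ?R"
      by (simp only: powr_add mult.assoc)
    also have "\<delta> / 4 * real (s n) + \<delta> / 2 * real (s n) + \<delta> / 4 * real (s n) = \<delta> * real (s n)"
      by (simp add: field_simps)
    finally show ?case by (simp only: mult.assoc)
  qed
  with \<epsilon>(1,3) show ?thesis by (intro exI[of _ \<epsilon>]) simp
qed

theorem theorem1p5:
  fixes G :: "nat \<Rightarrow> ('a, 'b) monoid_scheme"
    and Y :: "nat \<Rightarrow> 'a set"
    and m s s' :: "nat \<Rightarrow> nat"
  assumes "\<And>n. comm_group (G n)"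
    and "\<And>n. Y n \<subseteq> carrier (G n)"
    and "\<And>n. finite (Y n)"
    and "\<And>n. card (Y n) = n"
    and "\<And>n. m n > 0"
    and "\<And>n. s n > 0"
    and "\<And>n. s' n > 0"
    and "\<exists>C::real. C \<ge> 1 \<and> (\<forall>n. real (s n) / C \<le> real (s' n) \<and> real (s' n) \<le> C * real (s n))"
    and "\<And>n. s n + s' n \<le> m n"
    and "(\<lambda>n. real (m n)) \<in> o(\<lambda>n. (real (s n))\<^sup>2 / (log 2 (real n))\<^sup>2)"
  shows "\<exists>(\<epsilon> :: nat \<Rightarrow> real) (\<eta> :: nat \<Rightarrow> real).
    \<epsilon> \<longlonglongrightarrow> 0 \<and> \<eta> \<longlonglongrightarrow> 0 \<and>
    (\<forall>n. let \<beta> = real (max_subgroup_size (G n) ((1 + \<eta> n) * real (m n))) in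
      real (card {(A, B). A \<subseteq> Y n \<and> B \<subseteq> Y n \<and> card A = s n \<and> card B = s' n \<and>
                          card (A <#>\<^bsub>G n\<^esub> B) \<le> m n})
      \<le> 2 powr (\<epsilon> n * real (s n))
        * real_choose ((real (m n) + \<beta>) * real (s n) / real (s n + s' n)) (s n)
        * real_choose ((real (m n) + \<beta>) * real (s' n) / real (s n + s' n)) (s' n))"
proof -
  obtain C :: real where C: "C \<ge> 1" "\<And>n. real (s n) / C \<le> real (s' n)" "\<And>n. real (s' n) \<le> C * real (s n)"
    using assms(8) by blast
  let ?c = "\<lambda>n. real (card (small_pairs (G n) (s n) (s' n) (m n) (Y n) (Y n) {}))"
  let ?\<beta> = "\<lambda>n \<eta>. real (max_subgroup_size (G n) ((1 + \<eta>) * real (m n)))"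
  let ?r = "\<lambda>n \<eta>. real_choose ((real (m n) + ?\<beta> n \<eta>) * real (s n) / real (s n + s' n)) (s n)"
  let ?r' = "\<lambda>n \<eta>. real_choose ((real (m n) + ?\<beta> n \<eta>) * real (s' n) / real (s n + s' n)) (s' n)"
  let ?P = "\<lambda>n \<epsilon> \<eta>. ?c n \<le> 2 powr (\<epsilon> * real (s n)) * ?r n \<eta> * ?r' n \<eta>"
  have eq: "{(A, B). A \<subseteq> Y n \<and> B \<subseteq> Y n \<and> card A = s n \<and> card B = s' n \<and> card (A <#>\<^bsub>G n\<^esub> B) \<le> m n}
      = small_pairs (G n) (s n) (s' n) (m n) (Y n) (Y n) {}" for n
    by (simp add: small_pairs_def)
  have "\<exists>\<epsilon> \<eta>. \<epsilon> \<longlonglongrightarrow> 0 \<and> \<eta> \<longlonglongrightarrow> 0 \<and> (\<forall>n. ?P n (\<epsilon> n) (\<eta> n))"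
  proof (rule eventually_diagonal)
    show "\<exists>\<eta>\<ge>0. \<eta> \<le> \<delta> \<and> (\<forall>\<^sub>F n in sequentially. ?P n \<delta> \<eta>)" if "0 < \<delta>" for \<delta>
      by (rule eventually_small_pairs_bound[OF assms(1-4,6,7) C assms(9,10) that])
    show "\<exists>\<epsilon> \<eta>. ?P n \<epsilon> \<eta>" for n
    proof (intro exI)
      have T: "real (s n + s' n) \<le> real (m n) + ?\<beta> n 0" using assms(9)[of n] by linarith
      have r: "1 \<le> ?r n 0" "1 \<le> ?r' n 0"
        using real_choose_ge_one[OF assms(6)[of n] _ T] real_choose_ge_one[OF assms(7)[of n] _ T] by simp_all
      \<comment> \<open>For a single \<open>n\<close> the exponent may be so large that the power
        alone exceeds the count; the \<open>+ 1\<close> keeps the logarithm meaningful when there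
        are no pairs.\<close>
      have "?c n \<le> 2 powr (log 2 (?c n + 1) / real (s n) * real (s n)) * 1 * 1"
        using assms(6)[of n] by simp
      also have "\<dots> \<le> 2 powr (log 2 (?c n + 1) / real (s n) * real (s n)) * ?r n 0 * ?r' n 0"
        using r by (intro mult_mono) auto
      finally show "?P n (log 2 (?c n + 1) / real (s n)) 0" .
    qed
  qed
  then show ?thesis unfolding Let_def eq .
qed

end
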